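(* Let $\mathbf T=(T_1,\ldots,T_n)$ be a pure $\mathbf{\Theta}_n$-contraction on a Hilbert space $\mathcal H$. Suppose that $\{A_l^{(i)}:0\le l\le p,\ 1\le i\le n-1\}$ is a collection of bounded operators on $\mathcal D_{T_n^*}$ with $A_l^{(i)}=\big(A_{p-l}^{(n-i)}\big)^*$ for $0\le l\le p$, $1\le i\le n-1$, satisfying $$D_{T_n^*}T_i^*=\sum_{l=0}^{p}A_l^{(i)*}D_{T_n^*}T_n^{*l},\qquad 1\le i\le n-1 .$$ Let $\mathcal H_{T_n}=\big(H^2(\mathbb D)\otimes\mathcal D_{T_n^*}\big)\ominus M_{\Theta_{T_n}}\big(H^2(\mathbb D)\otimes\mathcal D_{T_n}\big)$. Then (1) for $1\le i\le n-1$, $T_i$ is unitarily equivalent to $P_{\mathcal H_{T_n}}\big(\sum_{l=0}^{p}M_z^l\otimes A_l^{(i)}\big)\big|_{\mathcal H_{T_n}}$; (2) $T_n$ is unitarily equivalent to $P_{\mathcal H_{T_n}}(M_z\otimes I_{\mathcal D_{T_n^*}})\big|_{\mathcal H_{T_n}}$.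
   Context: Fix positive integers $n$, $m$, $p$ with $p\mid m$, and put $q=m/p$. $\mathbb D$ is the open unit disc. Let $s_i(z_1,\ldots,z_n)=\sum_{1\le k_1<\cdots<k_i\le n}z_{k_1}\cdots z_{k_i}$. Define $\boldsymbol\theta=(\theta_1,\ldots,\theta_n):\mathbb C^n\to\mathbb C^n$ by $\theta_i(z)=s_i(z_1^m,\ldots,z_n^m)$ for $1\le i\le n-1$ and $\theta_n(z)=(z_1\cdots z_n)^q$. Set $\mathbf{\Theta}_n=\boldsymbol\theta(\mathbb D^n)$, $\overline{\mathbf{\Theta}}_n=\boldsymbol\theta(\overline{\mathbb D}^{\,n})$. A commuting $n$-tuple $\mathbf T$ of bounded operators on a Hilbert space is a $\mathbf{\Theta}_n$-contraction if $\overline{\mathbf{\Theta}}_n$ is a spectral set for it: its (Taylor) joint spectrum lies in $\overline{\mathbf{\Theta}}_n$ and $\|f(\mathbf T)\|\le\sup_{\overline{\mathbf{\Theta}}_n}|f|$ for every $f$ holomorphic on a neighbourhood of $\overline{\mathbf{\Theta}}_n$. It is pure if $T_n$ is a pure contraction, i.e. $T_n^{*k}\to0$ strongly as $k\to\infty$. For a contraction $S$, $D_S=(I-S^*S)^{1/2}$, $\mathcal D_S=\overline{\operatorname{Ran}}\,D_S$, and the characteristic function of $S$ is $\Theta_S(z)=\big(-S+D_{S^*}(I-zS^* )^{-1}z D_S\big)\big|_{\mathcal D_S}:\mathcal D_S\to\mathcal D_{S^*}$, $z\in\mathbb D$. $M_{\Theta_S}:H^2(\mathbb D)\otimes\mathcal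 D_S\to H^2(\mathbb D)\otimes\mathcal D_{S^*}$ is multiplication by $\Theta_S$: $(M_{\Theta_S}f)(z)=\Theta_S(z)f(z)$. $H^2(\mathbb D)$ is the Hardy space, $M_z$ is multiplication by $z$, and $P_{\mathcal M}$ is the orthogonal projection onto a closed subspace $\mathcal M$. *)

theory Defs
  imports "HOL-Complex_Analysis.Complex_Analysis"
begin

section \<open>Complex Hilbert spaces\<close>

class scaleC = scaleR +
  fixes scaleC :: "complex \<Rightarrow> 'a \<Rightarrow> 'a" (infixr \<open>*\<^sub>C\<close> 75)

text \<open>The inner product is linear in its first argument.\<close>

class complex_inner_space = real_normed_vector + scaleC +
  fixes cinner :: "'a \<Rightarrow> 'a \<Rightarrow> complex"
  assumes scaleC_add_right: "c *\<^sub>C (x + y) = c *\<^sub>C x + c *\<^sub>C y"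
    and scaleC_add_left: "(b + c) *\<^sub>C x = b *\<^sub>C x + c *\<^sub>C x"
    and scaleC_scaleC: "b *\<^sub>C c *\<^sub>C x = (b * c) *\<^sub>C x"
    and scaleR_scaleC: "r *\<^sub>R x = complex_of_real r *\<^sub>C x"
    and cinner_commute: "cinner x y = cnj (cinner y x)"
    and cinner_add_left: "cinner (x + y) z = cinner x z + cinner y z"
    and cinner_scaleC_left: "cinner (c *\<^sub>C x) y = c * cinner x y"
    and cinner_self_nonneg: "0 \<le> Re (cinner x x)"
    and norm_eq_sqrt_cinner: "norm x = sqrt (Re (cinner x x))"

class complex_hilbert_space = complex_inner_space + banach

instantiation complex :: complex_hilbert_space
begin

definition scaleC_complex :: "complex \<Rightarrow> complex \<Rightarrow> complex"
  where "scaleC_complex c z = c * z"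

definition cinner_complex :: "complex \<Rightarrow> complex \<Rightarrow> complex"
  where "cinner_complex w z = w * cnj z"

instance
  by standard
    (auto simp: scaleC_complex_def cinner_complex_def algebra_simps scaleR_conv_of_real
      complex_mult_cnj cmod_def power2_eq_square simp flip: of_real_mult of_real_add)

end

lemma scaleC_one [simp]: "1 *\<^sub>C x = (x::'a::complex_inner_space)"
  using scaleR_scaleC[of 1 x] by simp

lemma scaleC_zero_left [simp]: "0 *\<^sub>C x = (0::'a::complex_inner_space)"
  using scaleC_add_left[of 0 0 x] by simp

lemma scaleC_zero_right [simp]: "c *\<^sub>C 0 = (0::'a::complex_inner_space)"
  using scaleC_add_right[of c "0::'a" 0] by simp

lemma scaleC_minus_right: "c *\<^sub>C (- x) = - (c *\<^sub>C (x::'a::complex_inner_space))"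
  using scaleC_add_right[of c "x" "-x"] by (simp add: minus_unique)

lemma scaleC_diff_right: "c *\<^sub>C (x - y) = c *\<^sub>C x - c *\<^sub>C (y::'a::complex_inner_space)"
  using scaleC_add_right[of c x "- y"] by (simp add: scaleC_minus_right)

lemma scaleC_minus1: "(- 1) *\<^sub>C x = - (x::'a::complex_inner_space)"
  using scaleC_add_left[of 1 "-1" x] by (simp add: minus_unique)

lemma cinner_add_right:
  "cinner x (y + z) = cinner x y + cinner x (z::'a::complex_inner_space)"
  by (metis cinner_add_left cinner_commute complex_cnj_add)

lemma cinner_scaleC_right:
  "cinner x (c *\<^sub>C y) = cnj c * cinner x (y::'a::complex_inner_space)"
  by (metis cinner_commute cinner_scaleC_left complex_cnj_mult)

lemma cinner_zero_left [simp]: "cinner 0 (x::'a::complex_inner_space) = 0"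
  using cinner_scaleC_left[of 0 0 x] by simp

lemma cinner_zero_right [simp]: "cinner (x::'a::complex_inner_space) 0 = 0"
  by (metis cinner_zero_left cinner_commute complex_cnj_zero)

lemma cinner_minus_left: "cinner (- x) y = - cinner x (y::'a::complex_inner_space)"
  using cinner_scaleC_left[of "-1" x y] by (simp add: scaleC_minus1)

lemma cinner_diff_left: "cinner (x - y) z = cinner x z - cinner y (z::'a::complex_inner_space)"
  using cinner_add_left[of x "- y" z] by (simp add: cinner_minus_left)

lemma cinner_diff_right: "cinner z (x - y) = cinner z x - cinner z (y::'a::complex_inner_space)"
  by (metis cinner_commute cinner_diff_left complex_cnj_diff)

lemma cinner_self: "cinner x x = complex_of_real ((norm (x::'a::complex_inner_space))\<^sup>2)"
proof -
  have "Im (cinner x x) = 0"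
    using cinner_commute[of x x] by (metis cnj.sel(2) neg_equal_zero)
  moreover have "Re (cinner x x) = (norm x)\<^sup>2"
    using cinner_self_nonneg[of x] by (simp add: norm_eq_sqrt_cinner)
  ultimately show ?thesis
    by (simp add: complex_eq_iff)
qed

lemma norm_scaleC: "norm (c *\<^sub>C x) = cmod c * norm (x::'a::complex_inner_space)"
proof -
  have "complex_of_real ((norm (c *\<^sub>C x))\<^sup>2) = c * cnj c * complex_of_real ((norm x)\<^sup>2)"
    unfolding cinner_self[symmetric] cinner_scaleC_left cinner_scaleC_right by simp
  also have "\<dots> = complex_of_real ((cmod c * norm x)\<^sup>2)"
    by (simp only: complex_norm_square[symmetric] power_mult_distrib of_real_mult)
  finally have "(norm (c *\<^sub>C x))\<^sup>2 = (cmod c * norm x)\<^sup>2"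
    by (simp only: of_real_eq_iff)
  then show ?thesis
    by simp
qed

lemma cinner_norm_le: "cmod (cinner x y) \<le> norm x * norm (y::'a::complex_inner_space)"
proof (cases "y = 0")
  case False
  then have ny: "norm y > 0" by simp
  define a where "a = cinner x y"
  define N where "N = (norm y)\<^sup>2"
  have N: "N > 0" using ny by (simp add: N_def)
  define c where "c = a / complex_of_real N"
  have "cinner (x - c *\<^sub>C y) (x - c *\<^sub>C y)
      = complex_of_real ((norm x)\<^sup>2) - cnj c * a - c * cnj a + c * cnj c * complex_of_real N"
    unfolding cinner_diff_left cinner_diff_right cinner_scaleC_left cinner_scaleC_right
      cinner_self[of x] cinner_self[of y] a_def N_def
    by (simp add: algebra_simps cinner_commute[of y x])
  also have "\<dots> = complex_of_real ((norm x)\<^sup>2 - (cmod a)\<^sup>2 / N)"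
    using N by (simp add: c_def field_simps complex_norm_square del: of_real_power)
  finally have "(norm x)\<^sup>2 - (cmod a)\<^sup>2 / N = (norm (x - c *\<^sub>C y))\<^sup>2"
    unfolding cinner_self by (simp only: of_real_eq_iff)
  then have "(cmod a)\<^sup>2 / N \<le> (norm x)\<^sup>2"
    by (smt (verit) zero_le_power2)
  then have "(cmod a)\<^sup>2 \<le> (norm x * norm y)\<^sup>2"
    using N by (simp add: N_def field_simps power_mult_distrib)
  then show ?thesis
    unfolding a_def by (rule power2_le_imp_le) simp
qed simp

lemma bounded_linear_scaleC: "bounded_linear (scaleC c :: 'a::complex_inner_space \<Rightarrow> 'a)"
  by (rule bounded_linear_intro[where K = "cmod c"])
    (simp_all add: scaleC_add_right scaleR_scaleC scaleC_scaleC norm_scaleC mult.commute)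

lemma bounded_linear_cinner_left:
  "bounded_linear (\<lambda>x. cinner x (y::'a::complex_inner_space))"
  by (rule bounded_linear_intro[where K = "norm y"])
    (simp_all add: cinner_add_left scaleR_scaleC cinner_scaleC_left cinner_norm_le scaleC_complex_def)


section \<open>The vector-valued Hardy space\<close>

definition square_summable :: "(nat \<Rightarrow> 'a::complex_hilbert_space) \<Rightarrow> bool"
  where "square_summable a \<longleftrightarrow> summable (\<lambda>k. (norm (a k))\<^sup>2)"

definition disc_series :: "(nat \<Rightarrow> 'a::complex_hilbert_space) \<Rightarrow> complex \<Rightarrow> 'a"
  where "disc_series a z = (if cmod z < 1 then (\<Sum>k. z ^ k *\<^sub>C a k) else 0)"

lemma square_summable_zero [simp]: "square_summable (\<lambda>_. 0)"
  by (simp add: square_summable_def)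

lemma square_summable_scaleC:
  assumes "square_summable a" shows "square_summable (\<lambda>k. c *\<^sub>C a k)"
  using assms by (simp add: square_summable_def norm_scaleC power_mult_distrib summable_mult)

lemma square_summable_add:
  assumes "square_summable a" "square_summable b"
  shows "square_summable (\<lambda>k. a k + b k)"
  unfolding square_summable_def
proof (rule summable_comparison_test)
  have "(norm (a k + b k))\<^sup>2 \<le> 2 * (norm (a k))\<^sup>2 + 2 * (norm (b k))\<^sup>2" for k
  proof -
    have "(norm (a k + b k))\<^sup>2 \<le> (norm (a k) + norm (b k))\<^sup>2"
      by (intro power_mono norm_triangle_ineq) simp
    also have "\<dots> \<le> 2 * (norm (a k))\<^sup>2 + 2 * (norm (b k))\<^sup>2"
      using zero_le_power2[of "norm (a k) - norm (b k)"]
      by (simp add: power2_eq_square algebra_simps)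
    finally show ?thesis .
  qed
  then show "\<exists>N. \<forall>k\<ge>N. norm ((norm (a k + b k))\<^sup>2) \<le> 2 * (norm (a k))\<^sup>2 + 2 * (norm (b k))\<^sup>2"
    by auto
  show "summable (\<lambda>k. 2 * (norm (a k))\<^sup>2 + 2 * (norm (b k))\<^sup>2)"
    using assms unfolding square_summable_def by (intro summable_add summable_mult)
qed

lemma square_summable_diff:
  assumes "square_summable a" "square_summable b"
  shows "square_summable (\<lambda>k. a k - b k)"
  using square_summable_add[OF assms(1) square_summable_scaleC[OF assms(2), of "- 1"]]
  by (simp add: scaleC_minus1)

lemma square_summable_cinner:
  assumes "square_summable a" "square_summable b"
  shows "summable (\<lambda>k. cinner (a k) (b k))"
proof (rule summable_comparison_test)
  have "norm (cinner (a k) (b k)) \<le> (norm (a k))\<^sup>2 + (norm (b k))\<^sup>2" for k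
  proof -
    have "norm (cinner (a k) (b k)) \<le> norm (a k) * norm (b k)"
      by (rule cinner_norm_le)
    also have "\<dots> \<le> (norm (a k))\<^sup>2 + (norm (b k))\<^sup>2"
      using sum_squares_bound[of "norm (a k)" "norm (b k)"]
        mult_nonneg_nonneg[OF norm_ge_zero[of "a k"] norm_ge_zero[of "b k"]]
      by linarith
    finally show ?thesis .
  qed
  then show "\<exists>N. \<forall>k\<ge>N. norm (cinner (a k) (b k)) \<le> (norm (a k))\<^sup>2 + (norm (b k))\<^sup>2"
    by auto
  show "summable (\<lambda>k. (norm (a k))\<^sup>2 + (norm (b k))\<^sup>2)"
    using assms unfolding square_summable_def by (rule summable_add)
qed

lemma summable_disc_series:
  assumes "square_summable a" "cmod z < 1"
  shows "summable (\<lambda>k. z ^ k *\<^sub>C a k)"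
proof (rule summable_comparison_test)
  have "(\<lambda>k. (norm (a k))\<^sup>2) \<longlonglongrightarrow> 0"
    using assms(1) unfolding square_summable_def by (rule summable_LIMSEQ_zero)
  then have "eventually (\<lambda>k. (norm (a k))\<^sup>2 < 1) sequentially"
    by (rule order_tendstoD) simp
  then obtain N where "\<And>k. k \<ge> N \<Longrightarrow> (norm (a k))\<^sup>2 < 1"
    by (auto simp: eventually_sequentially)
  then have "\<And>k. k \<ge> N \<Longrightarrow> norm (a k) \<le> 1"
    by (metis less_imp_le norm_ge_zero abs_of_nonneg abs_square_le_1)
  then show "\<exists>N. \<forall>k\<ge>N. norm (z ^ k *\<^sub>C a k) \<le> cmod z ^ k"
    by (auto simp: norm_scaleC norm_power intro!: exI[of _ N] mult_left_le)
  show "summable (\<lambda>k. cmod z ^ k)"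
    using assms(2) by (simp add: summable_geometric)
qed

lemma disc_series_inj:
  assumes a: "square_summable a" and b: "square_summable b"
    and eq: "\<And>z. cmod z < 1 \<Longrightarrow> disc_series a z = disc_series b z"
  shows "a = b"
proof
  fix m
  define x where "x = a m - b m"
  define d where "d k = cinner (a k - b k) x" for k
  have sums: "(\<lambda>k. d k * z ^ k) sums 0" if z: "cmod z < 1" for z
  proof -
    have "(\<lambda>k. z ^ k *\<^sub>C a k - z ^ k *\<^sub>C b k) sums (disc_series a z - disc_series b z)"
      using z summable_disc_series[OF a z] summable_disc_series[OF b z]
      unfolding disc_series_def by (auto intro: sums_diff summable_sums)
    then have "(\<lambda>k. cinner (z ^ k *\<^sub>C a k - z ^ k *\<^sub>C b k) x) sums cinner 0 x"
      using eq[OF z] by (intro bounded_linear.sums[OF bounded_linear_cinner_left]) simp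
    then show ?thesis
      by (simp add: d_def scaleC_diff_right[symmetric] cinner_scaleC_left mult.commute)
  qed
  have "d m = 0"
  proof (rule ccontr)
    assume nz: "d m \<noteq> 0"
    define m0 where "m0 = (LEAST k. d k \<noteq> 0)"
    have m0: "d m0 \<noteq> 0"
      unfolding m0_def using nz by (rule LeastI)
    have m0_less: "d k = 0" if "k < m0" for k
      using not_less_Least[of k "\<lambda>k. d k \<noteq> 0"] that unfolding m0_def by blast
    have s2: "(\<lambda>k. d (k + m0) * z ^ k) sums 0" if z: "cmod z < 1" "z \<noteq> 0" for z
    proof -
      have "(\<lambda>k. d (k + m0) * z ^ (k + m0)) sums 0"
        using sums[OF z(1)] m0_less by (subst sums_zero_iff_shift) auto
      then have "(\<lambda>k. d (k + m0) * z ^ (k + m0) / z ^ m0) sums (0 / z ^ m0)"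
        by (rule sums_divide)
      then show ?thesis
        using z by (simp add: power_add)
    qed
    have "((\<lambda>z::complex. 0::complex) \<longlongrightarrow> d m0) (at 0)"
      using powser_limit_0_strong[of 1 "\<lambda>k. d (k + m0)" "\<lambda>z. 0"] s2 by simp
    then have "d m0 = 0"
      by (metis LIM_const_eq)
    with m0 show False by simp
  qed
  then have "norm x = 0"
    using cinner_self[of x] by (simp add: d_def x_def)
  then show "a m = b m"
    by (simp add: x_def)
qed

text \<open>\<open>'a hardy\<close> is \<open>H\<^sup>2(\<bbbD>) \<otimes> 'a\<close>, realised in the usual way as the space of
  \<open>'a\<close>-valued holomorphic functions on the open unit disc with square-summable Taylor
  coefficients (extended by 0 outside the disc, so that equality is equality on the disc).
  The scalar Hardy space is \<open>complex hardy\<close>.\<close>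

typedef (overloaded) ('a::complex_hilbert_space) hardy =
  "{disc_series a | a::nat \<Rightarrow> 'a. square_summable a}"
  morphisms hardy_eval Abs_hardy
  using square_summable_zero by blast

definition hardy_coeff :: "'a::complex_hilbert_space hardy \<Rightarrow> nat \<Rightarrow> 'a"
  where "hardy_coeff f = (THE a. square_summable a \<and> hardy_eval f = disc_series a)"

lemma hardy_coeff_eqI:
  assumes "square_summable a" "hardy_eval f = disc_series a"
  shows "hardy_coeff f = a"
  unfolding hardy_coeff_def
proof (rule the_equality)
  fix b assume "square_summable b \<and> hardy_eval f = disc_series b"
  then show "b = a"
    using assms by (intro disc_series_inj) auto
qed (use assms in simp)

lemma square_summable_hardy_coeff [simp]: "square_summable (hardy_coeff f)"
  and hardy_eval_conv_coeff: "hardy_eval f = disc_series (hardy_coeff f)"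
proof -
  obtain a where "square_summable a" "hardy_eval f = disc_series a"
    using hardy_eval[of f] by auto
  then show "square_summable (hardy_coeff f)" "hardy_eval f = disc_series (hardy_coeff f)"
    using hardy_coeff_eqI by metis+
qed

lemma hardy_eqI: "(\<And>k. hardy_coeff f k = hardy_coeff g k) \<Longrightarrow> f = g"
  by (metis hardy_eval_conv_coeff hardy_eval_inject ext)

lemma hardy_eval_eqI: "(\<And>z. cmod z < 1 \<Longrightarrow> hardy_eval f z = hardy_eval g z) \<Longrightarrow> f = g"
  by (metis disc_series_inj hardy_eqI hardy_eval_conv_coeff square_summable_hardy_coeff)

lemma hardy_eval_outside: "\<not> cmod z < 1 \<Longrightarrow> hardy_eval f z = 0"
  by (simp add: hardy_eval_conv_coeff disc_series_def)

lemma Abs_hardy_disc_series: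
  assumes "square_summable a"
  shows "hardy_eval (Abs_hardy (disc_series a)) = disc_series a"
    and "hardy_coeff (Abs_hardy (disc_series a)) = a"
proof -
  show *: "hardy_eval (Abs_hardy (disc_series a)) = disc_series a"
    by (rule Abs_hardy_inverse) (use assms in auto)
  show "hardy_coeff (Abs_hardy (disc_series a)) = a"
    by (rule hardy_coeff_eqI[OF assms *])
qed

lemma disc_series_add:
  assumes "square_summable a" "square_summable b"
  shows "disc_series a z + disc_series b z = disc_series (\<lambda>k. a k + b k) z"
  using assms by (auto simp: disc_series_def scaleC_add_right summable_disc_series suminf_add)

lemma disc_series_scaleC:
  assumes "square_summable a"
  shows "c *\<^sub>C disc_series a z = disc_series (\<lambda>k. c *\<^sub>C a k) z"
  using assms bounded_linear.suminf[OF bounded_linear_scaleC[of c] summable_disc_series[OF assms, of z]]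
  by (auto simp: disc_series_def scaleC_scaleC mult.commute)

instantiation hardy :: (complex_hilbert_space) complex_inner_space
begin

definition "0 = Abs_hardy (\<lambda>z. 0)"
definition "f + g = Abs_hardy (\<lambda>z. hardy_eval f z + hardy_eval g z)"
definition "- f = Abs_hardy (\<lambda>z. - hardy_eval f z)"
definition "f - g = Abs_hardy (\<lambda>z. hardy_eval f z - hardy_eval g z)"
definition "c *\<^sub>C f = Abs_hardy (\<lambda>z. c *\<^sub>C hardy_eval f z)"
definition "r *\<^sub>R f = Abs_hardy (\<lambda>z. r *\<^sub>R hardy_eval f z)"
definition "cinner f g = (\<Sum>k. cinner (hardy_coeff f k) (hardy_coeff g k))"
definition "norm f = sqrt (\<Sum>k. (norm (hardy_coeff f k))\<^sup>2)"
definition "dist f g = norm (f - g :: 'a hardy)"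
definition "sgn (f :: 'a hardy) = inverse (norm f) *\<^sub>R f"
definition "(uniformity :: ('a hardy \<times> 'a hardy) filter) =
  (INF e\<in>{0<..}. principal {(f, g). dist f g < e})"
definition "open (U :: 'a hardy set) \<longleftrightarrow>
  (\<forall>f\<in>U. eventually (\<lambda>(f', g). f' = f \<longrightarrow> g \<in> U) uniformity)"

lemma hardy_scaleC_aux:
  "Abs_hardy (\<lambda>z. c *\<^sub>C hardy_eval f z) = Abs_hardy (disc_series (\<lambda>k. c *\<^sub>C hardy_coeff f k))"
  by (simp add: hardy_eval_conv_coeff disc_series_scaleC)

lemma hardy_coeff_scaleC: "hardy_coeff (c *\<^sub>C f) k = c *\<^sub>C hardy_coeff f k"
  unfolding scaleC_hardy_def hardy_scaleC_aux
  by (simp add: Abs_hardy_disc_series square_summable_scaleC)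

lemma hardy_coeff_add: "hardy_coeff (f + g) k = hardy_coeff f k + hardy_coeff g k"
  unfolding plus_hardy_def
  by (simp add: hardy_eval_conv_coeff disc_series_add Abs_hardy_disc_series square_summable_add)

lemma hardy_minus_conv: "- f = (- 1) *\<^sub>C (f :: 'a hardy)"
  by (simp add: uminus_hardy_def scaleC_hardy_def scaleC_minus1)

lemma hardy_scaleR_conv: "r *\<^sub>R f = complex_of_real r *\<^sub>C (f :: 'a hardy)"
  by (simp add: scaleR_hardy_def scaleC_hardy_def scaleR_scaleC)

lemma hardy_coeff_minus: "hardy_coeff (- f) k = - hardy_coeff f k"
  by (simp add: hardy_minus_conv hardy_coeff_scaleC scaleC_minus1)

lemma hardy_coeff_zero: "hardy_coeff 0 k = 0"
proof -
  have "0 = Abs_hardy (disc_series (\<lambda>_. 0::'a))"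
    unfolding zero_hardy_def by (rule arg_cong[of _ _ Abs_hardy]) (auto simp: disc_series_def)
  then show ?thesis
    using Abs_hardy_disc_series(2)[OF square_summable_zero, where 'a = 'a] by simp
qed

lemma hardy_eval_add: "hardy_eval (f + g) z = hardy_eval f z + hardy_eval g z"
  unfolding hardy_eval_conv_coeff
  by (simp add: disc_series_add hardy_coeff_add[abs_def])

lemma hardy_eval_scaleC: "hardy_eval (c *\<^sub>C f) z = c *\<^sub>C hardy_eval f z"
  unfolding hardy_eval_conv_coeff
  by (simp add: disc_series_scaleC hardy_coeff_scaleC[abs_def])

lemma hardy_diff_conv: "f - g = f + - (g :: 'a hardy)"
  by (simp add: minus_hardy_def plus_hardy_def hardy_minus_conv hardy_eval_scaleC scaleC_minus1)

lemma hardy_coeff_diff: "hardy_coeff (f - g) k = hardy_coeff f k - hardy_coeff g k"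
  by (simp add: hardy_diff_conv hardy_coeff_add hardy_coeff_minus)

lemmas hardy_coeff_simps = hardy_coeff_add hardy_coeff_minus hardy_coeff_diff hardy_coeff_scaleC
  hardy_coeff_zero

lemma hardy_summable: "summable (\<lambda>k. (norm (hardy_coeff f k))\<^sup>2)"
  using square_summable_hardy_coeff[of f] by (simp only: square_summable_def)

lemma hardy_summable_cinner: "summable (\<lambda>k. cinner (hardy_coeff f k) (hardy_coeff g k))"
  by (simp add: square_summable_cinner)

lemma hardy_norm_sq: "(norm f)\<^sup>2 = (\<Sum>k. (norm (hardy_coeff f k))\<^sup>2)"
  by (simp add: norm_hardy_def suminf_nonneg hardy_summable)

lemma hardy_norm_nonneg: "0 \<le> norm (f :: 'a hardy)"
  by (simp add: norm_hardy_def suminf_nonneg hardy_summable)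

lemma hardy_cinner_self: "cinner f f = complex_of_real ((norm (f :: 'a hardy))\<^sup>2)"
  unfolding cinner_hardy_def cinner_self hardy_norm_sq
  by (rule suminf_of_real[symmetric]) (rule hardy_summable)

lemma hardy_sum_le_norm: "(\<Sum>k<K. (norm (hardy_coeff f k))\<^sup>2) \<le> (norm f)\<^sup>2"
  unfolding hardy_norm_sq by (rule sum_le_suminf) (simp_all add: hardy_summable)

lemma hardy_coeff_norm_le: "norm (hardy_coeff f k) \<le> norm f"
proof (rule power2_le_imp_le)
  have "(norm (hardy_coeff f k))\<^sup>2 \<le> (\<Sum>j<Suc k. (norm (hardy_coeff f j))\<^sup>2)"
    by (rule member_le_sum) auto
  then show "(norm (hardy_coeff f k))\<^sup>2 \<le> (norm f)\<^sup>2"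
    using hardy_sum_le_norm[where K = "Suc k" and f = f] by linarith
qed (rule hardy_norm_nonneg)

lemma hardy_norm_triangle: "norm (f + g) \<le> norm f + norm (g :: 'a hardy)"
proof -
  have L2: "L2_set (\<lambda>k. norm (hardy_coeff h k)) {..<K} \<le> norm h" for h :: "'a hardy" and K
    unfolding L2_set_def
    by (rule real_le_lsqrt) (simp_all add: sum_nonneg hardy_norm_nonneg hardy_sum_le_norm)
  have "(\<Sum>k<K. (norm (hardy_coeff (f + g) k))\<^sup>2) \<le> (norm f + norm g)\<^sup>2" for K
  proof -
    have "L2_set (\<lambda>k. norm (hardy_coeff (f + g) k)) {..<K}
        \<le> L2_set (\<lambda>k. norm (hardy_coeff f k) + norm (hardy_coeff g k)) {..<K}"
      by (rule L2_set_mono) (simp_all add: hardy_coeff_add norm_triangle_ineq)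
    also have "\<dots> \<le> L2_set (\<lambda>k. norm (hardy_coeff f k)) {..<K}
        + L2_set (\<lambda>k. norm (hardy_coeff g k)) {..<K}"
      by (rule L2_set_triangle_ineq)
    also have "\<dots> \<le> norm f + norm g"
      using L2 by (simp add: add_mono)
    finally have "(L2_set (\<lambda>k. norm (hardy_coeff (f + g) k)) {..<K})\<^sup>2 \<le> (norm f + norm g)\<^sup>2"
      by (rule power_mono) simp
    then show ?thesis
      by (simp add: L2_set_def sum_nonneg)
  qed
  then have "(norm (f + g))\<^sup>2 \<le> (norm f + norm g)\<^sup>2"
    unfolding hardy_norm_sq[of "f + g"] by (intro suminf_le_const hardy_summable) auto
  then show ?thesis
    by (rule power2_le_imp_le) (simp add: hardy_norm_nonneg)
qed

instance
proof
  fix f g h :: "'a hardy" and b c :: complex and r s :: real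
  show "dist f g = norm (f - g)" by (rule dist_hardy_def)
  show "f + g + h = f + (g + h)" "f + g = g + f" "0 + f = f" "- f + f = 0" "f - g = f + - g"
    by (auto intro!: hardy_eqI simp: hardy_coeff_simps)
  show "r *\<^sub>R (f + g) = r *\<^sub>R f + r *\<^sub>R g" "(r + s) *\<^sub>R f = r *\<^sub>R f + s *\<^sub>R f"
    "r *\<^sub>R s *\<^sub>R f = (r * s) *\<^sub>R f" "1 *\<^sub>R f = f"
    by (auto intro!: hardy_eqI simp: hardy_coeff_simps hardy_scaleR_conv scaleC_add_right
        scaleC_add_left scaleC_scaleC)
  show "sgn f = inverse (norm f) *\<^sub>R f" by (rule sgn_hardy_def)
  show "(uniformity :: ('a hardy \<times> 'a hardy) filter)
      = (INF e\<in>{0<..}. principal {(f, g). dist f g < e})"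
    by (rule uniformity_hardy_def)
  show "open U \<longleftrightarrow> (\<forall>f\<in>U. eventually (\<lambda>(f', g). f' = f \<longrightarrow> g \<in> U) uniformity)"
    for U :: "'a hardy set"
    by (rule open_hardy_def)
  show "(norm f = 0) = (f = 0)"
  proof
    assume "norm f = 0"
    then show "f = 0"
      using hardy_coeff_norm_le[of f] by (intro hardy_eqI) (simp add: hardy_coeff_simps)
  next
    assume "f = 0" then show "norm f = 0"
      by (simp add: norm_hardy_def hardy_coeff_simps)
  qed
  show "norm (f + g) \<le> norm f + norm g" by (rule hardy_norm_triangle)
  have sc: "norm (c *\<^sub>C f) = cmod c * norm f" for c
  proof -
    have "(norm (c *\<^sub>C f))\<^sup>2 = (cmod c * norm f)\<^sup>2"
      unfolding power_mult_distrib hardy_norm_sq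
      by (simp add: hardy_coeff_simps norm_scaleC power_mult_distrib suminf_mult hardy_summable)
    then show ?thesis
      by (simp add: hardy_norm_nonneg)
  qed
  show "norm (r *\<^sub>R f) = \<bar>r\<bar> * norm f"
    by (simp add: hardy_scaleR_conv sc)
  show "c *\<^sub>C (f + g) = c *\<^sub>C f + c *\<^sub>C g" "(b + c) *\<^sub>C f = b *\<^sub>C f + c *\<^sub>C f"
    "b *\<^sub>C c *\<^sub>C f = (b * c) *\<^sub>C f"
    by (auto intro!: hardy_eqI simp: hardy_coeff_simps scaleC_add_right scaleC_add_left scaleC_scaleC)
  show "r *\<^sub>R f = complex_of_real r *\<^sub>C f" by (rule hardy_scaleR_conv)
  show "cinner f g = cnj (cinner g f)"
    unfolding cinner_hardy_def
    by (subst bounded_linear.suminf[OF bounded_linear_cnj hardy_summable_cinner])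
      (simp add: cinner_commute[symmetric])
  show "cinner (f + g) h = cinner f h + cinner g h"
    by (simp add: cinner_hardy_def hardy_coeff_simps cinner_add_left suminf_add hardy_summable_cinner)
  show "cinner (c *\<^sub>C f) g = c * cinner f g"
    by (simp add: cinner_hardy_def hardy_coeff_simps cinner_scaleC_left suminf_mult hardy_summable_cinner)
  show "0 \<le> Re (cinner f f)" "norm f = sqrt (Re (cinner f f))"
    by (simp_all add: hardy_cinner_self hardy_norm_nonneg)
qed

end

instance hardy :: (complex_hilbert_space) complex_hilbert_space
proof
  fix X :: "nat \<Rightarrow> 'a hardy"
  assume X: "Cauchy X"
  have "Cauchy (\<lambda>n. hardy_coeff (X n) k)" for k
  proof (rule metric_CauchyI)
    fix e :: real assume "e > 0"
    then obtain N where N: "\<And>m n. m \<ge> N \<Longrightarrow> n \<ge> N \<Longrightarrow> dist (X m) (X n) < e"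
      using X unfolding Cauchy_def by metis
    have "dist (hardy_coeff (X m) k) (hardy_coeff (X n) k) \<le> dist (X m) (X n)" for m n
      unfolding dist_norm by (metis hardy_coeff_diff hardy_coeff_norm_le)
    then show "\<exists>N. \<forall>m\<ge>N. \<forall>n\<ge>N. dist (hardy_coeff (X m) k) (hardy_coeff (X n) k) < e"
      using N by (meson le_less_trans)
  qed
  then have "convergent (\<lambda>n. hardy_coeff (X n) k)" for k
    by (rule Cauchy_convergent)
  then obtain a where a: "\<And>k. (\<lambda>n. hardy_coeff (X n) k) \<longlonglongrightarrow> a k"
    unfolding convergent_def by metis
  have bound: "\<exists>N. \<forall>m\<ge>N. \<forall>K. (\<Sum>k<K. (norm (hardy_coeff (X m) k - a k))\<^sup>2) \<le> e\<^sup>2"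
    if "e > 0" for e
  proof -
    obtain N where N: "\<And>m n. m \<ge> N \<Longrightarrow> n \<ge> N \<Longrightarrow> dist (X m) (X n) < e"
      using X \<open>e > 0\<close> unfolding Cauchy_def by metis
    have "(\<Sum>k<K. (norm (hardy_coeff (X m) k - a k))\<^sup>2) \<le> e\<^sup>2" if m: "m \<ge> N" for m K
    proof (rule tendsto_upperbound)
      show "(\<lambda>n. \<Sum>k<K. (norm (hardy_coeff (X m) k - hardy_coeff (X n) k))\<^sup>2)
          \<longlonglongrightarrow> (\<Sum>k<K. (norm (hardy_coeff (X m) k - a k))\<^sup>2)"
        by (intro tendsto_sum tendsto_power tendsto_norm tendsto_diff tendsto_const a)
      have "(\<Sum>k<K. (norm (hardy_coeff (X m) k - hardy_coeff (X n) k))\<^sup>2) \<le> e\<^sup>2" if "n \<ge> N" for n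
      proof -
        have "(\<Sum>k<K. (norm (hardy_coeff (X m) k - hardy_coeff (X n) k))\<^sup>2) \<le> (norm (X m - X n))\<^sup>2"
          using hardy_sum_le_norm[where f = "X m - X n" and K = K] by (simp add: hardy_coeff_diff)
        also have "\<dots> \<le> e\<^sup>2"
          using N[OF m that] by (intro power_mono) (auto simp: dist_norm)
        finally show ?thesis .
      qed
      then show "eventually (\<lambda>n. (\<Sum>k<K. (norm (hardy_coeff (X m) k - hardy_coeff (X n) k))\<^sup>2) \<le> e\<^sup>2)
          sequentially"
        by (auto simp: eventually_sequentially)
    qed simp
    then show ?thesis by blast
  qed
  have ss: "square_summable a"
  proof -
    obtain N where N: "\<And>K. (\<Sum>k<K. (norm (hardy_coeff (X N) k - a k))\<^sup>2) \<le> 1\<^sup>2"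
      using bound[of 1] by auto
    have "square_summable (\<lambda>k. hardy_coeff (X N) k - a k)"
      unfolding square_summable_def
      by (rule bounded_imp_summable[where B = 1]) (use N[of "Suc _"] in \<open>auto simp: lessThan_Suc_atMost\<close>)
    from square_summable_diff[OF square_summable_hardy_coeff[of "X N"] this] show ?thesis
      by simp
  qed
  define f where "f = Abs_hardy (disc_series a)"
  have cf: "hardy_coeff f = a"
    unfolding f_def by (rule Abs_hardy_disc_series(2)[OF ss])
  have "X \<longlonglongrightarrow> f"
  proof (rule metric_LIMSEQ_I)
    fix e :: real assume "e > 0"
    then obtain N where N: "\<And>m K. m \<ge> N \<Longrightarrow> (\<Sum>k<K. (norm (hardy_coeff (X m) k - a k))\<^sup>2) \<le> (e / 2)\<^sup>2"
      using bound[of "e / 2"] by auto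
    have "dist (X m) f < e" if "m \<ge> N" for m
    proof -
      have "(norm (X m - f))\<^sup>2 \<le> (e / 2)\<^sup>2"
        unfolding hardy_norm_sq using N[OF that]
        by (intro suminf_le_const hardy_summable) (simp add: hardy_coeff_diff cf)
      then have "norm (X m - f) \<le> e / 2"
        by (rule power2_le_imp_le) (use \<open>e > 0\<close> in simp)
      then show ?thesis
        using \<open>e > 0\<close> by (simp add: dist_norm)
    qed
    then show "\<exists>N. \<forall>m\<ge>N. dist (X m) f < e" by blast
  qed
  then show "convergent X"
    by (auto simp: convergent_def)
qed


section \<open>Operators on closed subspaces\<close>

text \<open>Operators are total functions; an operator on a closed subspace \<open>M\<close> is only meaningful
  on \<open>M\<close>.\<close>

definition complex_subspace :: "'a::complex_inner_space set \<Rightarrow> bool"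
  where "complex_subspace M \<longleftrightarrow>
    0 \<in> M \<and> (\<forall>x\<in>M. \<forall>y\<in>M. x + y \<in> M) \<and> (\<forall>c. \<forall>x\<in>M. c *\<^sub>C x \<in> M)"

definition linear_map_on ::
    "'a::complex_inner_space set \<Rightarrow> ('a \<Rightarrow> 'b::complex_inner_space) \<Rightarrow> bool"
  where "linear_map_on M A \<longleftrightarrow>
    (\<forall>x\<in>M. \<forall>y\<in>M. A (x + y) = A x + A y) \<and> (\<forall>c. \<forall>x\<in>M. A (c *\<^sub>C x) = c *\<^sub>C A x)"

definition bounded_op_on :: "'a::complex_inner_space set \<Rightarrow> ('a \<Rightarrow> 'a) \<Rightarrow> bool"
  where "bounded_op_on M A \<longleftrightarrow>
    A ` M \<subseteq> M \<and> linear_map_on M A \<and> (\<exists>K. \<forall>x\<in>M. norm (A x) \<le> K * norm x)"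

abbreviation bounded_op :: "('a::complex_inner_space \<Rightarrow> 'a) \<Rightarrow> bool"
  where "bounded_op \<equiv> bounded_op_on UNIV"

definition adjoint_on :: "'a::complex_inner_space set \<Rightarrow> ('a \<Rightarrow> 'a) \<Rightarrow> 'a \<Rightarrow> 'a"
  where "adjoint_on M A y = (THE w. w \<in> M \<and> (\<forall>x\<in>M. cinner (A x) y = cinner x w))"

abbreviation adj :: "('a::complex_inner_space \<Rightarrow> 'a) \<Rightarrow> 'a \<Rightarrow> 'a"
  where "adj \<equiv> adjoint_on UNIV"

definition orth_proj :: "'a::complex_inner_space set \<Rightarrow> 'a \<Rightarrow> 'a"
  where "orth_proj M x = (THE y. y \<in> M \<and> (\<forall>w\<in>M. cinner (x - y) w = 0))"

definition orth_diff :: "'a::complex_inner_space set \<Rightarrow> 'a set \<Rightarrow> 'a set" (infixl \<open>\<ominus>\<close> 65)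
  where "N \<ominus> M = {x \<in> N. \<forall>y\<in>M. cinner x y = 0}"

definition unitarily_equivalent ::
    "'a::complex_inner_space set \<Rightarrow> ('a \<Rightarrow> 'a) \<Rightarrow> 'b::complex_inner_space set \<Rightarrow> ('b \<Rightarrow> 'b) \<Rightarrow> bool"
  where "unitarily_equivalent M S N R \<longleftrightarrow>
    (\<exists>U. linear_map_on M U \<and> (\<forall>x\<in>M. \<forall>y\<in>M. cinner (U x) (U y) = cinner x y) \<and>
      U ` M = N \<and> (\<forall>x\<in>M. U (S x) = R (U x)))"

definition contraction :: "('a::complex_inner_space \<Rightarrow> 'a) \<Rightarrow> bool"
  where "contraction S \<longleftrightarrow> bounded_op S \<and> (\<forall>x. norm (S x) \<le> norm x)"

definition pure_contraction :: "('a::complex_inner_space \<Rightarrow> 'a) \<Rightarrow> bool"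
  where "pure_contraction S \<longleftrightarrow> contraction S \<and> (\<forall>x. (\<lambda>k. (adj S ^^ k) x) \<longlonglongrightarrow> 0)"

definition op_sqrt :: "('a::complex_inner_space \<Rightarrow> 'a) \<Rightarrow> 'a \<Rightarrow> 'a"
  where "op_sqrt P =
    (THE Q. bounded_op Q \<and> (\<forall>x. cinner (Q x) x \<in> \<real>\<^sub>\<ge>\<^sub>0) \<and> (\<forall>x. Q (Q x) = P x))"

definition defect_op :: "('a::complex_inner_space \<Rightarrow> 'a) \<Rightarrow> 'a \<Rightarrow> 'a"
  where "defect_op S = op_sqrt (\<lambda>x. x - adj S (S x))"

definition defect_space :: "('a::complex_inner_space \<Rightarrow> 'a) \<Rightarrow> 'a set"
  where "defect_space S = closure (range (defect_op S))"

definition char_fun :: "('a::complex_inner_space \<Rightarrow> 'a) \<Rightarrow> complex \<Rightarrow> 'a \<Rightarrow> 'a"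
  where "char_fun S z x =
    - S x + defect_op (adj S) (inv (\<lambda>y. y - z *\<^sub>C adj S y) (z *\<^sub>C defect_op S x))"


section \<open>Operators on the Hardy space\<close>

text \<open>For a closed subspace \<open>E\<close>, \<open>hardy_space E\<close> is \<open>H\<^sup>2(\<bbbD>) \<otimes> E\<close>, the space of functions
  \<open>\<Sum>k. z\<^sup>k a\<^sub>k\<close> in \<open>'a hardy\<close> with all \<open>a\<^sub>k\<close> in \<open>E\<close>.\<close>

definition hardy_space :: "'a::complex_hilbert_space set \<Rightarrow> 'a hardy set"
  where "hardy_space E = {f. \<forall>k. hardy_coeff f k \<in> E}"

definition hardy_mult ::
    "(complex \<Rightarrow> 'a::complex_hilbert_space \<Rightarrow> 'b::complex_hilbert_space) \<Rightarrow> 'a hardy \<Rightarrow> 'b hardy"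
  where "hardy_mult F f = (THE g. \<forall>z. cmod z < 1 \<longrightarrow> hardy_eval g z = F z (hardy_eval f z))"

definition M_z :: "complex hardy \<Rightarrow> complex hardy"
  where "M_z = hardy_mult (\<lambda>z w. z * w)"

definition hardy_tensor :: "complex hardy \<Rightarrow> 'a::complex_hilbert_space \<Rightarrow> 'a hardy"
  where "hardy_tensor \<phi> x = Abs_hardy (\<lambda>z. hardy_eval \<phi> z *\<^sub>C x)"

text \<open>\<open>tensor_op E R A\<close> is the operator \<open>R \<otimes> A\<close> on \<open>H\<^sup>2(\<bbbD>) \<otimes> E\<close>; the last conjunct only fixes
  its values outside its domain.\<close>

definition tensor_op ::
    "'a::complex_hilbert_space set \<Rightarrow> (complex hardy \<Rightarrow> complex hardy) \<Rightarrow> ('a \<Rightarrow> 'a)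
      \<Rightarrow> 'a hardy \<Rightarrow> 'a hardy"
  where "tensor_op E R A =
    (THE B. bounded_op_on (hardy_space E) B \<and>
      (\<forall>\<phi>. \<forall>x\<in>E. B (hardy_tensor \<phi> x) = hardy_tensor (R \<phi>) (A x)) \<and>
      (\<forall>f. f \<notin> hardy_space E \<longrightarrow> B f = 0))"

lemma hardy_space_minus:
  assumes "complex_subspace E" "f \<in> hardy_space E" "g \<in> hardy_space E"
  shows "f - g \<in> hardy_space E"
proof -
  have "x - y \<in> E" if "x \<in> E" "y \<in> E" for x y
    using assms(1) that unfolding complex_subspace_def
    by (metis diff_conv_add_uminus scaleC_minus1)
  then show ?thesis
    using assms by (simp add: hardy_space_def hardy_coeff_simps)
qed

lemma hardy_eval_in_subspace:
  assumes E: "complex_subspace E" "closed E" and f: "f \<in> hardy_space E"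
  shows "hardy_eval f z \<in> E"
proof (cases "cmod z < 1")
  case True
  have "(\<Sum>k<N. z ^ k *\<^sub>C hardy_coeff f k) \<in> E" for N
    using E(1) f by (induction N) (auto simp: complex_subspace_def hardy_space_def)
  moreover have "(\<lambda>N. \<Sum>k<N. z ^ k *\<^sub>C hardy_coeff f k) \<longlonglongrightarrow> hardy_eval f z"
    using summable_LIMSEQ[OF summable_disc_series[OF square_summable_hardy_coeff[of f] True]] True
    by (simp add: hardy_eval_conv_coeff disc_series_def)
  ultimately show ?thesis
    by (rule closed_sequentially[OF E(2)])
qed (use E(1) in \<open>simp add: hardy_eval_outside complex_subspace_def\<close>)

lemma hardy_mult_eqI:
  assumes "\<And>z. cmod z < 1 \<Longrightarrow> hardy_eval g z = F z (hardy_eval f z)"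
  shows "hardy_mult F f = g"
  unfolding hardy_mult_def by (rule the_equality) (auto intro!: hardy_eval_eqI simp: assms)

text \<open>Coefficients of \<open>z \<mapsto> z\<^sup>l * f z\<close>.\<close>

definition shift_coeff :: "nat \<Rightarrow> (nat \<Rightarrow> 'a::complex_hilbert_space) \<Rightarrow> nat \<Rightarrow> 'a"
  where "shift_coeff l a k = (if k < l then 0 else a (k - l))"

lemma shift_coeff_norm:
  assumes "square_summable a"
  shows "square_summable (shift_coeff l a)"
    and "(\<Sum>k. (norm (shift_coeff l a k))\<^sup>2) = (\<Sum>k. (norm (a k))\<^sup>2)"
proof -
  have *: "(\<lambda>k. (norm (shift_coeff l a (k + l)))\<^sup>2) = (\<lambda>k. (norm (a k))\<^sup>2)"
    by (simp add: shift_coeff_def)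
  then show **: "square_summable (shift_coeff l a)"
    using assms summable_iff_shift[of "\<lambda>k. (norm (shift_coeff l a k))\<^sup>2" l]
    unfolding square_summable_def by simp
  show "(\<Sum>k. (norm (shift_coeff l a k))\<^sup>2) = (\<Sum>k. (norm (a k))\<^sup>2)"
    using ** unfolding square_summable_def
    by (subst suminf_split_initial_segment[of _ l]) (simp_all add: * , simp add: shift_coeff_def)
qed

lemma disc_series_shift:
  assumes "square_summable a"
  shows "disc_series (shift_coeff l a) z = z ^ l *\<^sub>C disc_series a z"
proof (cases "cmod z < 1")
  case True
  have "(\<Sum>k. z ^ k *\<^sub>C shift_coeff l a k)
      = (\<Sum>k. z ^ (k + l) *\<^sub>C shift_coeff l a (k + l)) + (\<Sum>k<l. z ^ k *\<^sub>C shift_coeff l a k)"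
    by (rule suminf_split_initial_segment[OF
          summable_disc_series[OF shift_coeff_norm(1)[OF assms] True]])
  also have "(\<Sum>k. z ^ (k + l) *\<^sub>C shift_coeff l a (k + l)) = (\<Sum>k. z ^ l *\<^sub>C z ^ k *\<^sub>C a k)"
    by (simp add: shift_coeff_def scaleC_scaleC power_add mult.commute)
  also have "(\<Sum>k<l. z ^ k *\<^sub>C shift_coeff l a k) = 0"
    by (simp add: shift_coeff_def)
  also have "(\<Sum>k. z ^ l *\<^sub>C z ^ k *\<^sub>C a k) = z ^ l *\<^sub>C (\<Sum>k. z ^ k *\<^sub>C a k)"
    by (rule bounded_linear.suminf[OF bounded_linear_scaleC summable_disc_series[OF assms True],
          symmetric])
  finally show ?thesis
    using True by (simp add: disc_series_def)
qed (simp add: disc_series_def)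

lemma hardy_eval_M_z: "hardy_eval (M_z \<phi>) z = z * hardy_eval \<phi> z"
proof -
  define g where "g = Abs_hardy (disc_series (shift_coeff 1 (hardy_coeff \<phi>)))"
  have g: "hardy_eval g z = z * hardy_eval \<phi> z" for z
    unfolding g_def
    by (simp add: Abs_hardy_disc_series shift_coeff_norm disc_series_shift hardy_eval_conv_coeff[of \<phi>]
        scaleC_complex_def)
  then have "M_z \<phi> = g"
    unfolding M_z_def by (intro hardy_mult_eqI) simp
  with g show ?thesis by simp
qed

lemma hardy_eval_M_z_power: "hardy_eval ((M_z ^^ l) \<phi>) z = z ^ l * hardy_eval \<phi> z"
  by (induction l) (simp_all add: hardy_eval_M_z)

lemma hardy_tensor_eval: "hardy_eval (hardy_tensor \<phi> x) z = hardy_eval \<phi> z *\<^sub>C x"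
  and hardy_tensor_coeff: "hardy_coeff (hardy_tensor \<phi> x) k = hardy_coeff \<phi> k *\<^sub>C x"
proof -
  have ss: "square_summable (\<lambda>k. hardy_coeff \<phi> k *\<^sub>C x)"
    using square_summable_hardy_coeff[of \<phi>]
    by (simp add: square_summable_def norm_scaleC power_mult_distrib summable_mult2)
  have bl: "bounded_linear (\<lambda>c. c *\<^sub>C x)"
    by (rule bounded_linear_intro[where K = "norm x"])
      (simp_all add: scaleC_add_left scaleR_scaleC[where 'a = 'a] scaleC_scaleC norm_scaleC
        scaleR_conv_of_real)
  have "hardy_eval \<phi> z *\<^sub>C x = disc_series (\<lambda>k. hardy_coeff \<phi> k *\<^sub>C x) z" for z
  proof (cases "cmod z < 1")
    case True
    show ?thesis
      using bounded_linear.suminf[OF bl summable_disc_series[OF square_summable_hardy_coeff True]] True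
      by (simp add: hardy_eval_conv_coeff disc_series_def scaleC_scaleC scaleC_complex_def)
  qed (simp add: hardy_eval_outside disc_series_def)
  then have *: "(\<lambda>z. hardy_eval \<phi> z *\<^sub>C x) = disc_series (\<lambda>k. hardy_coeff \<phi> k *\<^sub>C x)" ..
  show "hardy_eval (hardy_tensor \<phi> x) z = hardy_eval \<phi> z *\<^sub>C x"
    "hardy_coeff (hardy_tensor \<phi> x) k = hardy_coeff \<phi> k *\<^sub>C x"
    unfolding hardy_tensor_def * using Abs_hardy_disc_series[OF ss] * by (simp_all add: fun_eq_iff)
qed

lemma hardy_tensor_in_space:
  assumes "complex_subspace E" "x \<in> E"
  shows "hardy_tensor \<phi> x \<in> hardy_space E"
  using assms by (simp add: hardy_space_def hardy_tensor_coeff complex_subspace_def)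

lemma cinner_hardy_tensor:
  "cinner (hardy_tensor \<phi> x) (hardy_tensor \<psi> y) = cinner \<phi> \<psi> * cinner x y"
proof -
  have "cinner (hardy_tensor \<phi> x) (hardy_tensor \<psi> y)
      = (\<Sum>k. cinner (hardy_coeff \<phi> k) (hardy_coeff \<psi> k) * cinner x y)"
    by (simp add: cinner_hardy_def hardy_tensor_coeff cinner_scaleC_left cinner_scaleC_right
        cinner_complex_def mult.assoc mult.left_commute)
  also have "\<dots> = cinner \<phi> \<psi> * cinner x y"
    unfolding cinner_hardy_def by (rule suminf_mult2[symmetric]) (rule hardy_summable_cinner)
  finally show ?thesis .
qed

definition hardy_monom :: "nat \<Rightarrow> complex hardy"
  where "hardy_monom k = Abs_hardy (disc_series (\<lambda>j. if j = k then 1 else 0))"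

lemma hardy_monom_coeff: "hardy_coeff (hardy_monom k) j = (if j = k then 1 else 0)"
proof -
  have "square_summable (\<lambda>j. if j = k then 1 else 0 :: complex)"
    unfolding square_summable_def by (rule summable_finite[of "{k}"]) auto
  then show ?thesis
    by (simp add: hardy_monom_def Abs_hardy_disc_series)
qed

text \<open>Finite sums of elementary tensors are dense in \<open>H\<^sup>2(\<bbbD>) \<otimes> E\<close>.\<close>

definition hardy_trunc :: "'a::complex_hilbert_space hardy \<Rightarrow> nat \<Rightarrow> 'a hardy"
  where "hardy_trunc f N = (\<Sum>k<N. hardy_tensor (hardy_monom k) (hardy_coeff f k))"

lemma hardy_trunc_coeff: "hardy_coeff (hardy_trunc f N) k = (if k < N then hardy_coeff f k else 0)"
proof -
  have "hardy_coeff (hardy_trunc f N) k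
      = (\<Sum>j<N. hardy_coeff (hardy_tensor (hardy_monom j) (hardy_coeff f j)) k)"
    unfolding hardy_trunc_def by (induction N) (simp_all add: hardy_coeff_simps)
  also have "\<dots> = (\<Sum>j<N. if k = j then hardy_coeff f j else 0)"
    by (intro sum.cong) (auto simp: hardy_tensor_coeff hardy_monom_coeff)
  finally show ?thesis by simp
qed

lemma hardy_trunc_tendsto: "(\<lambda>N. norm (f - hardy_trunc f N)) \<longlonglongrightarrow> 0"
proof -
  have eq: "(norm (f - hardy_trunc f N))\<^sup>2
      = (\<Sum>k. (norm (hardy_coeff f k))\<^sup>2) - (\<Sum>k<N. (norm (hardy_coeff f k))\<^sup>2)" for N
  proof -
    have "(norm (f - hardy_trunc f N))\<^sup>2
        = (\<Sum>k. (norm (hardy_coeff (f - hardy_trunc f N) (k + N)))\<^sup>2)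
          + (\<Sum>k<N. (norm (hardy_coeff (f - hardy_trunc f N) k))\<^sup>2)"
      unfolding hardy_norm_sq by (rule suminf_split_initial_segment) (rule hardy_summable)
    also have "\<dots> = (\<Sum>k. (norm (hardy_coeff f (k + N)))\<^sup>2)"
      by (simp add: hardy_coeff_simps hardy_trunc_coeff)
    finally show ?thesis
      using suminf_split_initial_segment[OF hardy_summable[of f], of N] by simp
  qed
  have "(\<lambda>N. (\<Sum>k. (norm (hardy_coeff f k))\<^sup>2) - (\<Sum>k<N. (norm (hardy_coeff f k))\<^sup>2)) \<longlonglongrightarrow>
      (\<Sum>k. (norm (hardy_coeff f k))\<^sup>2) - (\<Sum>k. (norm (hardy_coeff f k))\<^sup>2)"
    by (intro tendsto_diff tendsto_const summable_LIMSEQ hardy_summable)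
  then have "(\<lambda>N. sqrt ((norm (f - hardy_trunc f N))\<^sup>2)) \<longlonglongrightarrow> sqrt 0"
    unfolding eq by (intro tendsto_real_sqrt) simp
  then show ?thesis
    by simp
qed

lemma bounded_op_on_diff:
  assumes "bounded_op_on M A" "complex_subspace M" "x \<in> M" "y \<in> M"
  shows "A (x - y) = A x - A y"
proof -
  have "A (x + (- 1) *\<^sub>C y) = A x + (- 1) *\<^sub>C A y"
    using assms by (metis bounded_op_on_def linear_map_on_def complex_subspace_def)
  then show ?thesis
    by (simp add: scaleC_minus1)
qed

lemma bounded_op_on_bound:
  assumes "bounded_op_on M A"
  obtains K where "K \<ge> 0" "\<And>x. x \<in> M \<Longrightarrow> norm (A x) \<le> K * norm x"
proof -
  obtain K where K: "\<And>x. x \<in> M \<Longrightarrow> norm (A x) \<le> K * norm x"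
    using assms by (auto simp: bounded_op_on_def)
  show ?thesis
  proof (rule that[of "\<bar>K\<bar>"])
    show "norm (A x) \<le> \<bar>K\<bar> * norm x" if "x \<in> M" for x
      using K[OF that] mult_right_mono[OF abs_ge_self[of K] norm_ge_zero[of x]] by linarith
  qed simp
qed

lemma complex_subspace_hardy_space:
  "complex_subspace E \<Longrightarrow> complex_subspace (hardy_space E)"
  by (simp add: complex_subspace_def hardy_space_def hardy_coeff_simps)

lemma hardy_trunc_in_space:
  "complex_subspace E \<Longrightarrow> f \<in> hardy_space E \<Longrightarrow> hardy_trunc f N \<in> hardy_space E"
  by (simp add: hardy_space_def hardy_trunc_coeff complex_subspace_def)

lemma tensor_op_unique:
  assumes E: "complex_subspace E"
    and B: "bounded_op_on (hardy_space E) B" and C: "bounded_op_on (hardy_space E) C"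
    and eq: "\<And>\<phi> x. x \<in> E \<Longrightarrow> B (hardy_tensor \<phi> x) = C (hardy_tensor \<phi> x)"
    and f: "f \<in> hardy_space E"
  shows "B f = C f"
proof -
  note S = complex_subspace_hardy_space[OF E]
  have trunc: "B (hardy_trunc f N) = C (hardy_trunc f N)" for N
  proof (induction N)
    case 0
    have "0 \<in> hardy_space E" using S by (simp add: complex_subspace_def)
    from bounded_op_on_diff[OF B S this this] bounded_op_on_diff[OF C S this this]
    show ?case by (simp add: hardy_trunc_def)
  next
    case (Suc N)
    define t where "t = hardy_tensor (hardy_monom N) (hardy_coeff f N)"
    have c: "hardy_coeff f N \<in> E" using f by (simp add: hardy_space_def)
    have t: "t \<in> hardy_space E" unfolding t_def by (rule hardy_tensor_in_space[OF E c])
    have "hardy_trunc f (Suc N) = hardy_trunc f N + t"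
      by (simp add: hardy_trunc_def t_def)
    then show ?case
      using Suc eq[OF c, of "hardy_monom N"] B C hardy_trunc_in_space[OF E f, of N] t
      unfolding t_def[symmetric] by (simp add: bounded_op_on_def linear_map_on_def)
  qed
  obtain K where K: "\<And>g. g \<in> hardy_space E \<Longrightarrow> norm (B g) \<le> K * norm g"
    using bounded_op_on_bound[OF B] by metis
  obtain L where L: "\<And>g. g \<in> hardy_space E \<Longrightarrow> norm (C g) \<le> L * norm g"
    using bounded_op_on_bound[OF C] by metis
  have "norm (B f - C f) \<le> (K + L) * norm (f - hardy_trunc f N)" for N
  proof -
    define h where "h = f - hardy_trunc f N"
    have h: "h \<in> hardy_space E"
      unfolding h_def by (rule hardy_space_minus[OF E f hardy_trunc_in_space[OF E f]])
    have "B f - C f = B h - C h"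
      unfolding h_def
      using bounded_op_on_diff[OF B S f hardy_trunc_in_space[OF E f]]
        bounded_op_on_diff[OF C S f hardy_trunc_in_space[OF E f]] trunc[of N] by simp
    then have "norm (B f - C f) \<le> norm (B h) + norm (C h)"
      by (simp add: norm_triangle_ineq4)
    also have "\<dots> \<le> (K + L) * norm h"
      using K[OF h] L[OF h] by (simp add: algebra_simps)
    finally show ?thesis by (simp add: h_def)
  qed
  moreover have "(\<lambda>N. (K + L) * norm (f - hardy_trunc f N)) \<longlonglongrightarrow> (K + L) * 0"
    by (intro tendsto_mult tendsto_const hardy_trunc_tendsto)
  ultimately have "norm (B f - C f) \<le> (K + L) * 0"
    by (intro LIMSEQ_le_const) auto
  then show ?thesis by simp
qed

text \<open>On \<open>H\<^sup>2(\<bbbD>) \<otimes> E\<close> the operator \<open>M\<^sub>z\<^sup>l \<otimes> A\<close> exists and is multiplication by \<open>z\<^sup>l A\<close>.\<close>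

lemma tensor_op_M_z:
  assumes E: "complex_subspace E" "closed E" and A: "bounded_op_on E A"
  shows "bounded_op_on (hardy_space E) (tensor_op E (M_z ^^ l) A)"
    and "x \<in> E \<Longrightarrow>
      tensor_op E (M_z ^^ l) A (hardy_tensor \<phi> x) = hardy_tensor ((M_z ^^ l) \<phi>) (A x)"
    and "f \<in> hardy_space E \<Longrightarrow>
      hardy_eval (tensor_op E (M_z ^^ l) A f) z = z ^ l *\<^sub>C A (hardy_eval f z)"
proof -
  obtain K where K0: "K \<ge> 0" and K: "\<And>x. x \<in> E \<Longrightarrow> norm (A x) \<le> K * norm x"
    using bounded_op_on_bound[OF A] by blast
  have AE: "A x \<in> E" if "x \<in> E" for x
    using A that by (auto simp: bounded_op_on_def)
  have A_add: "A (x + y) = A x + A y" if "x \<in> E" "y \<in> E" for x y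
    using A that by (simp add: bounded_op_on_def linear_map_on_def)
  have A_scaleC: "A (c *\<^sub>C x) = c *\<^sub>C A x" if "x \<in> E" for c x
    using A that by (simp add: bounded_op_on_def linear_map_on_def)
  have A0: "A 0 = 0"
    using A_scaleC[of 0 0] E(1) by (simp add: complex_subspace_def)
  have cE: "hardy_coeff f k \<in> E" if "f \<in> hardy_space E" for f k
    using that by (simp add: hardy_space_def)
  define B where "B f = (if f \<in> hardy_space E
    then Abs_hardy (disc_series (shift_coeff l (\<lambda>k. A (hardy_coeff f k)))) else 0)" for f
  have le: "(norm (A (hardy_coeff f k)))\<^sup>2 \<le> K\<^sup>2 * (norm (hardy_coeff f k))\<^sup>2"
    if "f \<in> hardy_space E" for f k
    using power_mono[OF K[OF cE[OF that, of k]], of 2] by (simp add: power_mult_distrib)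
  have ss: "square_summable (\<lambda>k. A (hardy_coeff f k))" if "f \<in> hardy_space E" for f
    unfolding square_summable_def
    by (rule summable_comparison_test[OF _ summable_mult[OF hardy_summable[of f], of "K\<^sup>2"]])
      (use le[OF that] in auto)
  have B_coeff: "hardy_coeff (B f) k = shift_coeff l (\<lambda>k. A (hardy_coeff f k)) k"
    if "f \<in> hardy_space E" for f k
    using that by (simp add: B_def Abs_hardy_disc_series shift_coeff_norm ss)
  have B_in: "B f \<in> hardy_space E" if "f \<in> hardy_space E" for f
    using that E(1) AE by (simp add: hardy_space_def B_coeff shift_coeff_def complex_subspace_def)
  have B_eval: "hardy_eval (B f) z = z ^ l *\<^sub>C A (hardy_eval f z)" if f: "f \<in> hardy_space E" for f z
  proof -
    have "disc_series (\<lambda>k. A (hardy_coeff f k)) z = A (hardy_eval f z)"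
    proof (cases "cmod z < 1")
      case True
      define s where "s N = (\<Sum>k<N. z ^ k *\<^sub>C hardy_coeff f k)" for N
      have sE: "s N \<in> E \<and> A (s N) = (\<Sum>k<N. z ^ k *\<^sub>C A (hardy_coeff f k))" for N
        using E(1) cE[OF f] unfolding s_def
        by (induction N) (auto simp: complex_subspace_def A_add A_scaleC A0)
      have lim: "s \<longlonglongrightarrow> hardy_eval f z"
        using summable_LIMSEQ[OF summable_disc_series[OF square_summable_hardy_coeff[of f] True]] True
        by (simp add: s_def[abs_def] hardy_eval_conv_coeff disc_series_def)
      have "(\<lambda>N. A (s N)) \<longlonglongrightarrow> A (hardy_eval f z)"
      proof (rule Lim_null_comparison[THEN LIM_zero_cancel])
        have "norm (A (s N) - A (hardy_eval f z)) \<le> K * norm (s N - hardy_eval f z)" for N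
          using K[of "s N - hardy_eval f z"] sE[of N] hardy_eval_in_subspace[OF E f, of z]
            bounded_op_on_diff[OF A E(1), of "s N" "hardy_eval f z"] E(1)
          unfolding complex_subspace_def by (metis diff_conv_add_uminus scaleC_minus1)
        then show "\<forall>\<^sub>F N in sequentially.
            norm (A (s N) - A (hardy_eval f z)) \<le> K * norm (s N - hardy_eval f z)"
          by simp
        have "(\<lambda>N. K * norm (s N - hardy_eval f z)) \<longlonglongrightarrow> K * 0"
          by (intro tendsto_mult tendsto_const tendsto_norm_zero LIM_zero lim)
        then show "(\<lambda>N. K * norm (s N - hardy_eval f z)) \<longlonglongrightarrow> 0" by simp
      qed
      moreover have "(\<lambda>N. A (s N)) \<longlonglongrightarrow> disc_series (\<lambda>k. A (hardy_coeff f k)) z"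
        using summable_LIMSEQ[OF summable_disc_series[OF ss[OF f] True]] True sE
        by (simp add: disc_series_def)
      ultimately show ?thesis
        using LIMSEQ_unique by blast
    qed (simp add: hardy_eval_outside disc_series_def A0)
    then show ?thesis
      using f by (simp add: B_def Abs_hardy_disc_series shift_coeff_norm ss disc_series_shift)
  qed
  have B_bounded: "bounded_op_on (hardy_space E) B"
    unfolding bounded_op_on_def linear_map_on_def
  proof (intro conjI ballI allI)
    show "B ` hardy_space E \<subseteq> hardy_space E" using B_in by auto
    have S: "complex_subspace (hardy_space E)" by (rule complex_subspace_hardy_space[OF E(1)])
    show "B (f + g) = B f + B g" if "f \<in> hardy_space E" "g \<in> hardy_space E" for f g
    proof -
      have "f + g \<in> hardy_space E" using S that by (simp add: complex_subspace_def)
      with that show ?thesis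
        by (auto intro!: hardy_eqI simp: B_coeff hardy_coeff_simps shift_coeff_def A_add cE)
    qed
    show "B (c *\<^sub>C f) = c *\<^sub>C B f" if "f \<in> hardy_space E" for c f
    proof -
      have "c *\<^sub>C f \<in> hardy_space E" using S that by (simp add: complex_subspace_def)
      with that show ?thesis
        by (auto intro!: hardy_eqI simp: B_coeff hardy_coeff_simps shift_coeff_def A_scaleC cE)
    qed
    show "\<exists>K. \<forall>f\<in>hardy_space E. norm (B f) \<le> K * norm f"
    proof (intro exI ballI)
      fix f assume f: "f \<in> hardy_space E"
      have "(norm (B f))\<^sup>2 = (\<Sum>k. (norm (A (hardy_coeff f k)))\<^sup>2)"
        unfolding hardy_norm_sq B_coeff[OF f] by (rule shift_coeff_norm(2)[OF ss[OF f]])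
      also have "\<dots> \<le> (\<Sum>k. K\<^sup>2 * (norm (hardy_coeff f k))\<^sup>2)"
        using ss[OF f] by (intro suminf_le le f summable_mult hardy_summable)
          (simp add: square_summable_def)
      also have "\<dots> = (K * norm f)\<^sup>2"
        by (simp add: suminf_mult hardy_summable hardy_norm_sq power_mult_distrib)
      finally show "norm (B f) \<le> K * norm f"
        by (rule power2_le_imp_le) (use K0 in simp)
    qed
  qed
  have B_tensor: "B (hardy_tensor \<phi> x) = hardy_tensor ((M_z ^^ l) \<phi>) (A x)" if "x \<in> E" for \<phi> x
    by (rule hardy_eval_eqI)
      (simp add: B_eval hardy_tensor_in_space[OF E(1) that] hardy_tensor_eval hardy_eval_M_z_power
        A_scaleC that scaleC_scaleC)
  have "tensor_op E (M_z ^^ l) A = B"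
    unfolding tensor_op_def
  proof (rule the_equality)
    show "bounded_op_on (hardy_space E) B \<and>
        (\<forall>\<phi>. \<forall>x\<in>E. B (hardy_tensor \<phi> x) = hardy_tensor ((M_z ^^ l) \<phi>) (A x)) \<and>
        (\<forall>f. f \<notin> hardy_space E \<longrightarrow> B f = 0)"
      using B_bounded B_tensor by (auto simp: B_def)
    fix C
    assume C: "bounded_op_on (hardy_space E) C \<and>
        (\<forall>\<phi>. \<forall>x\<in>E. C (hardy_tensor \<phi> x) = hardy_tensor ((M_z ^^ l) \<phi>) (A x)) \<and>
        (\<forall>f. f \<notin> hardy_space E \<longrightarrow> C f = 0)"
    show "C = B"
    proof
      fix f
      show "C f = B f"
      proof (cases "f \<in> hardy_space E")
        case True
        show ?thesis
          by (rule tensor_op_unique[OF E(1) _ B_bounded _ True]) (use C B_tensor in auto)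
      next
        case False
        then show ?thesis using C by (simp add: B_def)
      qed
    qed
  qed
  with B_bounded B_tensor B_eval
  show "bounded_op_on (hardy_space E) (tensor_op E (M_z ^^ l) A)"
    "x \<in> E \<Longrightarrow> tensor_op E (M_z ^^ l) A (hardy_tensor \<phi> x) = hardy_tensor ((M_z ^^ l) \<phi>) (A x)"
    "f \<in> hardy_space E \<Longrightarrow>
      hardy_eval (tensor_op E (M_z ^^ l) A f) z = z ^ l *\<^sub>C A (hardy_eval f z)"
    by simp_all
qed

definition char_model_space :: "('a::complex_hilbert_space \<Rightarrow> 'a) \<Rightarrow> 'a hardy set"
  where "char_model_space S =
    hardy_space (defect_space (adj S)) \<ominus> hardy_mult (char_fun S) ` hardy_space (defect_space S)"


section \<open>Taylor joint spectrum, holomorphic functional calculus and spectral sets\<close>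

text \<open>An \<open>n\<close>-tuple is a function on \<open>nat\<close> of which only the values on \<open>{1..n}\<close> matter;
  \<open>\<complex>\<^sup>n\<close> is the product space \<open>cn_top n\<close>, whose points are extensional functions on \<open>{1..n}\<close>.\<close>

abbreviation cn_top :: "nat \<Rightarrow> (nat \<Rightarrow> complex) topology"
  where "cn_top n \<equiv> product_topology (\<lambda>_. euclidean) {1..n}"

text \<open>The Koszul complex \<open>\<Lambda>(\<complex>\<^sup>n) \<otimes> 'a\<close>: \<open>\<omega> S\<close> is the coefficient of
  \<open>e\<^bsub>i1\<^esub> \<and> \<dots> \<and> e\<^bsub>ik\<^esub>\<close> for \<open>S = {i1 < \<dots> < ik}\<close>, and \<open>koszul_d n T\<close> is
  \<open>\<Sum>i. (e\<^sub>i \<and> _) \<otimes> T i\<close>. As it is homogeneous of degree 1, the complex is exact iff its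
  kernel equals its range.\<close>

definition koszul_space :: "nat \<Rightarrow> (nat set \<Rightarrow> 'a::complex_inner_space) set"
  where "koszul_space n = {\<omega>. \<forall>S. \<not> S \<subseteq> {1..n} \<longrightarrow> \<omega> S = 0}"

definition koszul_d ::
    "nat \<Rightarrow> (nat \<Rightarrow> 'a::complex_inner_space \<Rightarrow> 'a) \<Rightarrow> (nat set \<Rightarrow> 'a) \<Rightarrow> nat set \<Rightarrow> 'a"
  where "koszul_d n T \<omega> S =
    (if S \<subseteq> {1..n} then \<Sum>i\<in>S. (- 1) ^ card {j \<in> S. j < i} *\<^sub>R T i (\<omega> (S - {i})) else 0)"

definition taylor_nonsingular :: "nat \<Rightarrow> (nat \<Rightarrow> 'a::complex_inner_space \<Rightarrow> 'a) \<Rightarrow> bool"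
  where "taylor_nonsingular n T \<longleftrightarrow>
    {\<omega> \<in> koszul_space n. koszul_d n T \<omega> = (\<lambda>_. 0)} = koszul_d n T ` koszul_space n"

definition taylor_spectrum ::
    "nat \<Rightarrow> (nat \<Rightarrow> 'a::complex_inner_space \<Rightarrow> 'a) \<Rightarrow> (nat \<Rightarrow> complex) set"
  where "taylor_spectrum n T =
    {z \<in> topspace (cn_top n). \<not> taylor_nonsingular n (\<lambda>i x. T i x - z i *\<^sub>C x)}"

text \<open>Holomorphic in several variables: continuous and holomorphic in each variable.\<close>

definition holomorphic_cn :: "nat \<Rightarrow> (nat \<Rightarrow> complex) set \<Rightarrow> ((nat \<Rightarrow> complex) \<Rightarrow> complex) \<Rightarrow> bool"
  where "holomorphic_cn n U f \<longleftrightarrow>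
    openin (cn_top n) U \<and> continuous_map (subtopology (cn_top n) U) euclidean f \<and>
    (\<forall>z\<in>U. \<forall>i\<in>{1..n}. (\<lambda>w. f (z(i := w))) field_differentiable at (z i))"

definition holomorphic_near ::
    "nat \<Rightarrow> (nat \<Rightarrow> complex) set \<Rightarrow> ((nat \<Rightarrow> complex) \<Rightarrow> complex) set"
  where "holomorphic_near n K = {f. \<exists>U. K \<subseteq> U \<and> holomorphic_cn n U f}"

text \<open>\<open>\<Phi>\<close> is the Taylor functional calculus \<open>f \<mapsto> f(T)\<close> on the algebra of germs of holomorphic
  functions on the joint spectrum. It is given by the properties of Taylor's existence theorem,
  which determine it uniquely by Putinar's theorem: it is a continuous unital algebra
  homomorphism which sends the coordinate functions to \<open>T\<close> and has the spectral mapping property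
  for finite tuples of functions.\<close>

definition taylor_calculus ::
    "nat \<Rightarrow> (nat \<Rightarrow> 'a::complex_inner_space \<Rightarrow> 'a) \<Rightarrow> (((nat \<Rightarrow> complex) \<Rightarrow> complex) \<Rightarrow> 'a \<Rightarrow> 'a) \<Rightarrow> bool"
  where "taylor_calculus n T \<Phi> \<longleftrightarrow>
    (let \<sigma> = taylor_spectrum n T; \<O> = holomorphic_near n \<sigma> in
      (\<forall>f\<in>\<O>. bounded_op (\<Phi> f)) \<and>
      (\<forall>f\<in>\<O>. \<forall>g\<in>\<O>. (\<exists>U. openin (cn_top n) U \<and> \<sigma> \<subseteq> U \<and> (\<forall>z\<in>U. f z = g z)) \<longrightarrow> \<Phi> f = \<Phi> g) \<and>
      (\<forall>f\<in>\<O>. \<forall>g\<in>\<O>. \<Phi> (\<lambda>z. f z + g z) = (\<lambda>x. \<Phi> f x + \<Phi> g x)) \<and>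
      (\<forall>f\<in>\<O>. \<forall>g\<in>\<O>. \<Phi> (\<lambda>z. f z * g z) = \<Phi> f \<circ> \<Phi> g) \<and>
      (\<forall>c. \<Phi> (\<lambda>z. c) = (\<lambda>x. c *\<^sub>C x)) \<and>
      (\<forall>i\<in>{1..n}. \<Phi> (\<lambda>z. z i) = T i) \<and>
      (\<forall>U F f. \<sigma> \<subseteq> U \<longrightarrow> (\<forall>k. holomorphic_cn n U (F k)) \<longrightarrow> holomorphic_cn n U f \<longrightarrow>
        (\<forall>C. compactin (cn_top n) C \<and> C \<subseteq> U \<longrightarrow> uniform_limit C F f sequentially) \<longrightarrow>
        (\<lambda>k. onorm (\<lambda>x. \<Phi> (F k) x - \<Phi> f x)) \<longlonglongrightarrow> 0) \<and>
      (\<forall>N F. (\<forall>j\<in>{1..N}. F j \<in> \<O>) \<longrightarrow>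
        taylor_spectrum N (\<lambda>j. \<Phi> (F j)) = (\<lambda>z. \<lambda>j\<in>{1..N}. F j z) ` \<sigma>))"

definition spectral_set ::
    "nat \<Rightarrow> (nat \<Rightarrow> complex) set \<Rightarrow> (nat \<Rightarrow> 'a::complex_inner_space \<Rightarrow> 'a) \<Rightarrow> bool"
  where "spectral_set n K T \<longleftrightarrow>
    taylor_spectrum n T \<subseteq> K \<and>
    (\<exists>\<Phi>. taylor_calculus n T \<Phi> \<and>
      (\<forall>f\<in>holomorphic_near n K. onorm (\<Phi> f) \<le> (SUP z\<in>K. cmod (f z))))"


section \<open>\<open>\<Theta>\<^sub>n\<close>-contractions\<close>

definition elem_sym :: "nat \<Rightarrow> nat \<Rightarrow> (nat \<Rightarrow> complex) \<Rightarrow> complex"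
  where "elem_sym n i z = (\<Sum>S | S \<subseteq> {1..n} \<and> card S = i. \<Prod>k\<in>S. z k)"

definition theta :: "nat \<Rightarrow> nat \<Rightarrow> nat \<Rightarrow> (nat \<Rightarrow> complex) \<Rightarrow> nat \<Rightarrow> complex"
  where "theta n m p z =
    (\<lambda>i\<in>{1..n}. if i < n then elem_sym n i (\<lambda>k. z k ^ m) else (\<Prod>k=1..n. z k) ^ (m div p))"

definition closed_Theta :: "nat \<Rightarrow> nat \<Rightarrow> nat \<Rightarrow> (nat \<Rightarrow> complex) set"
  where "closed_Theta n m p = theta n m p ` (\<Pi>\<^sub>E k\<in>{1..n}. cball 0 1)"

definition Theta_contraction ::
    "nat \<Rightarrow> nat \<Rightarrow> nat \<Rightarrow> (nat \<Rightarrow> 'a::complex_hilbert_space \<Rightarrow> 'a) \<Rightarrow> bool"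
  where "Theta_contraction n m p T \<longleftrightarrow>
    (\<forall>i\<in>{1..n}. bounded_op (T i)) \<and>
    (\<forall>i\<in>{1..n}. \<forall>j\<in>{1..n}. T i \<circ> T j = T j \<circ> T i) \<and>
    spectral_set n (closed_Theta n m p) T"

definition pure_Theta_contraction ::
    "nat \<Rightarrow> nat \<Rightarrow> nat \<Rightarrow> (nat \<Rightarrow> 'a::complex_hilbert_space \<Rightarrow> 'a) \<Rightarrow> bool"
  where "pure_Theta_contraction n m p T \<longleftrightarrow> Theta_contraction n m p T \<and> pure_contraction (T n)"

end

theory Submission
  imports Defs
begin

text \<open>Write \<open>S = T n\<close>. Since \<open>S\<close> is pure, \<open>W x = (\<Sum>k. z\<^sup>k D\<^bsub>S*\<^esub> S*\<^sup>k x)\<close> is an isometry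
  (the norms telescope), and it intertwines \<open>S*\<close> with the backward shift. Its range is the model
  space: the characteristic function is the transfer function of the unitary colligation
  \<open>(u, g) \<mapsto> (S* u + D\<^sub>S g, D\<^bsub>S*\<^esub> u - S g)\<close>, and running this system backwards writes every \<open>f\<close> in
  \<open>H\<^sup>2 \<otimes> \<D>\<^bsub>S*\<^esub>\<close> as \<open>W x + \<Theta>\<^sub>S g\<close>. Evaluating the relation between \<open>T\<^sub>i*\<close> and the \<open>A\<^sub>l*\<close> at
  \<open>S*\<^sup>k x\<close> and using that \<open>T\<^sub>i*\<close> commutes with \<open>S*\<close> gives
  \<open>(\<Sum>l. M\<^sub>z\<^sup>l \<otimes> A\<^sub>l)* W = W T\<^sub>i*\<close>, and compressing to the range of \<open>W\<close> gives the claim.\<close>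

section \<open>Riesz representation and adjoints\<close>

lemma norm_add_sq:
  "(norm (x + y))\<^sup>2 = (norm x)\<^sup>2 + 2 * Re (cinner x y) + (norm (y::'a::complex_inner_space))\<^sup>2"
proof -
  have "Re (cinner (x + y) (x + y)) = Re (cinner x x) + 2 * Re (cinner x y) + Re (cinner y y)"
    using arg_cong[OF cinner_commute[of y x], of Re] by (simp add: cinner_add_left cinner_add_right)
  then show ?thesis
    unfolding cinner_self Re_complex_of_real .
qed

lemma norm_diff_sq:
  "(norm (x - y))\<^sup>2 = (norm x)\<^sup>2 - 2 * Re (cinner x y) + (norm (y::'a::complex_inner_space))\<^sup>2"
  using norm_add_sq[of x "- y"] by (simp add: cinner_diff_right[of x 0 y, simplified])

lemma cinner_ext_right:
  assumes "\<And>x. cinner x y = cinner x z"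
  shows "y = (z::'a::complex_inner_space)"
  using cinner_self[of "y - z"] assms[of "y - z"] by (simp add: cinner_diff_right)

lemma tendsto_cinner:
  assumes "(f \<longlongrightarrow> a) F" "(g \<longlongrightarrow> (b::'a::complex_inner_space)) F"
  shows "((\<lambda>k. cinner (f k) (g k)) \<longlongrightarrow> cinner a b) F"
proof -
  have "bounded_bilinear (cinner :: 'a \<Rightarrow> 'a \<Rightarrow> complex)"
    by (standard; (simp add: cinner_add_left cinner_add_right scaleR_scaleC cinner_scaleC_left
        cinner_scaleC_right scaleC_complex_def)?)
      (auto intro!: exI[of _ 1] cinner_norm_le)
  then show ?thesis
    using assms by (rule bounded_bilinear.tendsto)
qed

text \<open>First-order condition at a minimum: for small \<open>t\<close> the linear term
  dominates. In the witness \<open>- b / (a + 1)\<close> the \<open>+ 1\<close> also covers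
  \<open>a = 0\<close>.\<close>

lemma quadratic_nonneg_linear_zero:
  fixes a b :: real
  assumes "a \<ge> 0" "\<And>t. 0 \<le> 2 * t * b + t\<^sup>2 * a"
  shows "b = 0"
proof (rule ccontr)
  assume "b \<noteq> 0"
  have "2 * (- b / (a + 1)) * b + (- b / (a + 1))\<^sup>2 * a = b\<^sup>2 * (- a - 2) / (a + 1)\<^sup>2"
    using assms(1) by (simp add: divide_simps) (simp add: power2_eq_square algebra_simps)
  moreover have "\<dots> < 0"
    using assms(1) \<open>b \<noteq> 0\<close> by (intro divide_neg_pos mult_pos_neg) auto
  ultimately show False
    using assms(2)[of "- b / (a + 1)"] by linarith
qed

lemma complex_subspace_diff:
  "complex_subspace M \<Longrightarrow> x \<in> M \<Longrightarrow> y \<in> M \<Longrightarrow> x - y \<in> M"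
  unfolding complex_subspace_def by (metis diff_conv_add_uminus scaleC_minus1)

lemma complex_subspace_scaleR:
  "complex_subspace M \<Longrightarrow> x \<in> M \<Longrightarrow> r *\<^sub>R x \<in> M"
  by (simp add: complex_subspace_def scaleR_scaleC)

lemma complex_subspace_UNIV [simp]: "complex_subspace UNIV"
  by (simp add: complex_subspace_def)

text \<open>The representing vector minimises \<open>(norm x)\<^sup>2 - 2 * Re (\<phi> x)\<close> on \<open>M\<close>.\<close>

lemma riesz_representation:
  fixes M :: "'a::complex_hilbert_space set"
  assumes M: "complex_subspace M" "closed M"
    and add: "\<And>x y. x \<in> M \<Longrightarrow> y \<in> M \<Longrightarrow> \<phi> (x + y) = \<phi> x + \<phi> y"
    and scale: "\<And>c x. x \<in> M \<Longrightarrow> \<phi> (c *\<^sub>C x) = c * \<phi> x"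
    and bound: "\<And>x. x \<in> M \<Longrightarrow> cmod (\<phi> x) \<le> K * norm x"
  shows "\<exists>w\<in>M. \<forall>x\<in>M. \<phi> x = cinner x w"
proof -
  define J where "J x = (norm x)\<^sup>2 - 2 * Re (\<phi> x)" for x
  have scaleR: "\<phi> (r *\<^sub>R x) = of_real r * \<phi> x" if "x \<in> M" for r x
    using scale[OF that, of "of_real r"] by (simp add: scaleR_scaleC)
  have add_in: "x + y \<in> M" if "x \<in> M" "y \<in> M" for x y
    using M(1) that by (simp add: complex_subspace_def)
  have zero: "0 \<in> M" using M(1) by (simp add: complex_subspace_def)
  \<comment> \<open>Completing the square in \<open>norm x\<close>.\<close>
  have J_ge: "J x \<ge> - K\<^sup>2" if "x \<in> M" for x
  proof -
    have "Re (\<phi> x) \<le> K * norm x"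
      using complex_Re_le_cmod[of "\<phi> x"] bound[OF that] by linarith
    moreover have "0 \<le> (norm x - K)\<^sup>2" by simp
    ultimately show ?thesis
      unfolding J_def power2_diff by (simp add: algebra_simps)
  qed
  then have bdd: "bdd_below (J ` M)" by (rule bdd_belowI2)
  define I where "I = Inf (J ` M)"
  have I_le: "I \<le> J x" if "x \<in> M" for x
    unfolding I_def using that bdd by (simp add: cINF_lower)
  have "\<exists>x\<in>M. J x < I + 1 / real (Suc k)" for k
  proof -
    have "Inf (J ` M) < I + 1 / real (Suc k)" by (simp add: I_def)
    then show ?thesis
      using zero bdd by (subst (asm) cInf_less_iff) auto
  qed
  then obtain X where X: "\<And>k. X k \<in> M" "\<And>k. J (X k) < I + 1 / real (Suc k)"
    by metis
  \<comment> \<open>Parallelogram law: the midpoint of \<open>x\<close> and \<open>y\<close> lies in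
    \<open>M\<close>, so its value is at least \<open>I\<close>. Hence near-minimisers are close to
    each other.\<close>
  have gap: "(norm (x - y))\<^sup>2 \<le> 2 * J x + 2 * J y - 4 * I" if "x \<in> M" "y \<in> M" for x y
  proof -
    have "J ((1 / 2) *\<^sub>R (x + y)) = (norm (x + y))\<^sup>2 / 4 - Re (\<phi> x) - Re (\<phi> y)"
      using that by (simp add: J_def scaleR add add_in power_divide add_divide_distrib del: scaleR_add_right)
    moreover have "I \<le> J ((1 / 2) *\<^sub>R (x + y))"
      by (intro I_le complex_subspace_scaleR[OF M(1)] add_in that)
    ultimately show ?thesis
      using norm_add_sq[of x y] norm_diff_sq[of x y] unfolding J_def[of x] J_def[of y] by argo
  qed
  have "Cauchy X"
  proof (rule metric_CauchyI)
    fix e :: real assume e: "e > 0"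
    \<comment> \<open>The excesses of \<open>J (X i)\<close> and \<open>J (X j)\<close> over
      \<open>I\<close> enter \<open>gap\<close> with factor 2 each, which gives the 4.\<close>
    obtain N where N: "1 / real (Suc N) < e\<^sup>2 / 4"
      by (rule nat_approx_posE[of "e\<^sup>2 / 4"]) (use e in simp)
    have "dist (X i) (X j) < e" if "i \<ge> N" "j \<ge> N" for i j
    proof -
      have le: "1 / real (Suc i) \<le> 1 / real (Suc N)" "1 / real (Suc j) \<le> 1 / real (Suc N)"
        using that by (simp_all add: frac_le)
      have "(norm (X i - X j))\<^sup>2 < e\<^sup>2"
        using gap[OF X(1) X(1), of i j] X(2)[of i] X(2)[of j] le N by linarith
      then show ?thesis
        using e by (simp add: dist_norm power_less_imp_less_base)
    qed
    then show "\<exists>N. \<forall>m\<ge>N. \<forall>n\<ge>N. dist (X m) (X n) < e" by blast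
  qed
  then obtain w where w: "X \<longlonglongrightarrow> w"
    using Cauchy_convergent convergent_def by blast
  have wM: "w \<in> M" by (rule closed_sequentially[OF M(2) X(1) w])
  have "(\<lambda>k. \<phi> (X k)) \<longlonglongrightarrow> \<phi> w"
  proof (rule Lim_null_comparison[THEN LIM_zero_cancel])
    have "\<phi> (X k) - \<phi> w = \<phi> (X k - w)" for k
      using add[OF complex_subspace_diff[OF M(1) X(1) wM] wM, of k] by simp
    then show "\<forall>\<^sub>F k in sequentially. norm (\<phi> (X k) - \<phi> w) \<le> K * norm (X k - w)"
      using bound[OF complex_subspace_diff[OF M(1) X(1) wM]] by simp
    have "(\<lambda>k. K * norm (X k - w)) \<longlonglongrightarrow> K * 0"
      by (intro tendsto_mult tendsto_const tendsto_norm_zero LIM_zero w)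
    then show "(\<lambda>k. K * norm (X k - w)) \<longlonglongrightarrow> 0" by simp
  qed
  then have "(\<lambda>k. J (X k)) \<longlonglongrightarrow> J w"
    unfolding J_def by (intro tendsto_intros w)
  moreover have "(\<lambda>k. I + 1 / real (Suc k)) \<longlonglongrightarrow> I + 0"
    by (intro tendsto_intros LIMSEQ_Suc lim_1_over_n)
  ultimately have Jw: "J w \<le> I"
    using X(2) by (intro LIMSEQ_le[where Y = "\<lambda>k. I + 1 / real (Suc k)"]) (auto intro: less_imp_le)
  \<comment> \<open>Vanishing first variation of \<open>J\<close> at the minimiser \<open>w\<close>
    in the direction \<open>v\<close>.\<close>
  have Re_eq: "Re (\<phi> v) = Re (cinner v w)" if v: "v \<in> M" for v
  proof -
    have "0 \<le> 2 * t * (Re (cinner v w) - Re (\<phi> v)) + t\<^sup>2 * (norm v)\<^sup>2" for t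
    proof -
      have "w + t *\<^sub>R v \<in> M" by (intro add_in wM complex_subspace_scaleR[OF M(1) v])
      then have "J w \<le> J (w + t *\<^sub>R v)" using I_le Jw by fastforce
      moreover have "Re (cinner w (t *\<^sub>R v)) = t * Re (cinner v w)"
        using arg_cong[OF cinner_commute[of v w], of Re]
        by (simp add: scaleR_scaleC cinner_scaleC_right)
      ultimately show ?thesis
        using add[OF wM complex_subspace_scaleR[OF M(1) v], of t] v
        by (simp add: J_def norm_add_sq scaleR power_mult_distrib algebra_simps)
    qed
    from quadratic_nonneg_linear_zero[OF _ this] show ?thesis by simp
  qed
  have "\<phi> v = cinner v w" if v: "v \<in> M" for v
  proof (rule complex_eqI)
    show "Re (\<phi> v) = Re (cinner v w)" by (rule Re_eq[OF v])
    \<comment> \<open>The imaginary part of a complex linear functional is read off from its real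
      part at \<open>\<i> *\<^sub>C v\<close>.\<close>
    have "\<i> *\<^sub>C v \<in> M" using M(1) v by (simp add: complex_subspace_def)
    from Re_eq[OF this] show "Im (\<phi> v) = Im (cinner v w)"
      using v by (simp add: scale cinner_scaleC_left)
  qed
  with wM show ?thesis by blast
qed

text \<open>Riesz on \<open>M\<close> supplies the vector that the definite description asks for;
  testing on the difference of two candidates, which lies in \<open>M\<close>, shows uniqueness. The
  vector \<open>y\<close> may lie outside \<open>M\<close>.\<close>

lemma cinner_adjoint_on:
  fixes M :: "'a::complex_hilbert_space set"
  assumes M: "complex_subspace M" "closed M" and A: "bounded_op_on M A"
    and x: "x \<in> M"
  shows "cinner (A x) y = cinner x (adjoint_on M A y)"
proof -
  obtain K where K: "K \<ge> 0" "\<And>x. x \<in> M \<Longrightarrow> norm (A x) \<le> K * norm x"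
    using bounded_op_on_bound[OF A] by blast
  have "cmod (cinner (A x) y) \<le> (K * norm y) * norm x" if "x \<in> M" for x
    using cinner_norm_le[of "A x" y] mult_right_mono[OF K(2)[OF that] norm_ge_zero[of y]]
    by (simp add: mult_ac)
  then have "\<exists>w\<in>M. \<forall>x\<in>M. cinner (A x) y = cinner x w"
    using A by (intro riesz_representation[OF M])
      (auto simp: bounded_op_on_def linear_map_on_def cinner_add_left cinner_scaleC_left)
  then obtain w where w: "w \<in> M" "\<And>x. x \<in> M \<Longrightarrow> cinner (A x) y = cinner x w" by blast
  have "adjoint_on M A y = w"
    unfolding adjoint_on_def
  proof (rule the_equality)
    fix v assume v: "v \<in> M \<and> (\<forall>x\<in>M. cinner (A x) y = cinner x v)"
    then have "cinner (v - w) (v - w) = 0"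
      using w complex_subspace_diff[OF M(1), of v w] by (simp add: cinner_diff_right)
    then show "v = w" by (simp add: cinner_self)
  qed (use w in blast)
  with w(2)[OF x] show ?thesis by simp
qed

section \<open>Adjoints and linearity of operators on the whole space\<close>

lemma cinner_adj:
  fixes S :: "'a::complex_hilbert_space \<Rightarrow> 'a"
  assumes "bounded_op S"
  shows "cinner (S x) y = cinner x (adj S y)"
  by (rule cinner_adjoint_on) (simp_all add: assms)

lemma cinner_adj_left:
  fixes S :: "'a::complex_hilbert_space \<Rightarrow> 'a"
  assumes "bounded_op S"
  shows "cinner (adj S x) y = cinner x (S y)"
  by (metis cinner_adj[OF assms] cinner_commute)

lemma bounded_op_linear:
  assumes "bounded_op S"
  shows bounded_op_add: "S (x + y) = S x + S y"
    and bounded_op_scaleC: "S (c *\<^sub>C x) = c *\<^sub>C S x"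
    and bounded_op_scaleR: "S (r *\<^sub>R x) = r *\<^sub>R S x"
    and bounded_op_diff: "S (x - y) = S x - S y"
    and bounded_op_zero: "S 0 = 0"
    and bounded_op_bounded_linear: "bounded_linear S"
proof -
  show add: "S (x + y) = S x + S y" and sc: "S (c *\<^sub>C x) = c *\<^sub>C S x" for c x y
    using assms by (simp_all add: bounded_op_on_def linear_map_on_def)
  show sr: "S (r *\<^sub>R x) = r *\<^sub>R S x" for r x
    by (simp add: scaleR_scaleC sc)
  obtain K where "\<And>x. norm (S x) \<le> K * norm x"
    using bounded_op_on_bound[OF assms] by auto
  then show "bounded_linear S"
    by (intro bounded_linear_intro[where K = K]) (simp_all add: add sr mult.commute)
  show "S (x - y) = S x - S y" by (rule bounded_op_on_diff[OF assms]) simp_all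
  show "S 0 = 0" using sc[of 0 0] by simp
qed

lemma bounded_opI:
  assumes "\<And>x y. S (x + y) = S x + S y" "\<And>c x. S (c *\<^sub>C x) = c *\<^sub>C S x"
    "\<And>x. norm (S x) \<le> K * norm x"
  shows "bounded_op S"
  using assms by (auto simp: bounded_op_on_def linear_map_on_def)

text \<open>Estimate the squared norm of \<open>adj S x\<close> as the inner product of
  \<open>S (adj S x)\<close> with \<open>x\<close> and cancel one factor. Keeping the same
  \<open>K\<close> makes adjoints of contractions contractions.\<close>

lemma bounded_op_adj:
  fixes S :: "'a::complex_hilbert_space \<Rightarrow> 'a"
  assumes S: "bounded_op S" and K: "\<And>x. norm (S x) \<le> K * norm x"
  shows bounded_op_adjI: "bounded_op (adj S)"
    and norm_adj_le: "norm (adj S x) \<le> K * norm x"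
proof -
  show le: "norm (adj S x) \<le> K * norm x" for x
  proof (cases "adj S x = 0")
    \<comment> \<open>No sign is assumed for \<open>K\<close>; nonnegativity of
      \<open>K * norm x\<close> comes from the bound on \<open>S x\<close>.\<close>
    case True
    show ?thesis
      using order_trans[OF norm_ge_zero K[of x]] True by simp
  next
    case False
    have "(norm (adj S x))\<^sup>2 = Re (cinner (S (adj S x)) x)"
      by (simp add: cinner_adj[OF S] cinner_self)
    also have "\<dots> \<le> norm (S (adj S x)) * norm x"
      using complex_Re_le_cmod cinner_norm_le order_trans by blast
    also have "\<dots> \<le> K * norm (adj S x) * norm x"
      by (intro mult_right_mono K) simp
    finally show ?thesis
      using False by (simp add: power2_eq_square mult_ac)
  qed
  show "bounded_op (adj S)"
    by (rule bounded_opI[OF _ _ le]; rule cinner_ext_right)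
      (simp_all add: cinner_adj[OF S, symmetric] cinner_add_right cinner_scaleC_right)
qed

lemma adj_adj:
  fixes S :: "'a::complex_hilbert_space \<Rightarrow> 'a"
  assumes "bounded_op S"
  shows "adj (adj S) = S"
proof -
  obtain K where "\<And>x. norm (S x) \<le> K * norm x"
    using bounded_op_on_bound[OF assms] by auto
  then have "bounded_op (adj S)" using bounded_op_adjI[OF assms] by blast
  then show ?thesis
    by - (rule ext, rule cinner_ext_right, simp add: cinner_adj[symmetric] cinner_adj_left assms)
qed

lemma adj_commute:
  fixes S R :: "'a::complex_hilbert_space \<Rightarrow> 'a"
  assumes "bounded_op S" "bounded_op R" "S \<circ> R = R \<circ> S"
  shows "adj S (adj R x) = adj R (adj S x)"
  using fun_cong[OF assms(3)]
  by - (rule cinner_ext_right, simp add: cinner_adj[symmetric] assms(1,2))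


section \<open>The positive square root of \<open>I - T\<close>\<close>

text \<open>If \<open>Q = I - Y\<close> then \<open>Q\<^sup>2 = I - T\<close> amounts to the fixed point equation
  \<open>Y = (T + Y\<^sup>2) / 2\<close>. The iterates are polynomials in \<open>T\<close> with nonnegative coefficients, and so
  are their successive differences; \<open>sqrt_bound k\<close> is the value of the \<open>k\<close>-th polynomial at 1.\<close>

primrec sqrt_iter :: "('a::complex_hilbert_space \<Rightarrow> 'a) \<Rightarrow> nat \<Rightarrow> 'a \<Rightarrow> 'a" where
  "sqrt_iter T 0 = (\<lambda>x. 0)"
| "sqrt_iter T (Suc k) = (\<lambda>x. (1 / 2) *\<^sub>R (T x + sqrt_iter T k (sqrt_iter T k x)))"

primrec sqrt_bound :: "nat \<Rightarrow> real" where
  "sqrt_bound 0 = 0"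
| "sqrt_bound (Suc k) = (1 + (sqrt_bound k)\<^sup>2) / 2"

text \<open>The solution \<open>Y\<close> of the fixed point equation, as the strong limit of the
  iterates.\<close>

definition id_minus_sqrt :: "('a::complex_hilbert_space \<Rightarrow> 'a) \<Rightarrow> 'a \<Rightarrow> 'a"
  where "id_minus_sqrt T x = lim (\<lambda>k. sqrt_iter T k x)"

lemma sqrt_bound: "0 \<le> sqrt_bound k" "sqrt_bound k \<le> 1"
proof -
  have "0 \<le> sqrt_bound k \<and> sqrt_bound k \<le> 1"
    by (induction k) (auto simp: power_le_one)
  then show "0 \<le> sqrt_bound k" "sqrt_bound k \<le> 1" by auto
qed

lemma sqrt_bound_mono: "sqrt_bound k \<le> sqrt_bound (Suc k)"
  using zero_le_power2[of "sqrt_bound k - 1"] by (simp add: power2_diff)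

text \<open>Applied below to \<open>adj S\<close> composed with \<open>S\<close>, for which
  \<open>I - T\<close> is the square of the defect operator.\<close>

locale selfadjoint_contraction =
  fixes T :: "'a::complex_hilbert_space \<Rightarrow> 'a"
  assumes bounded: "bounded_op T"
    and norm_le: "norm (T x) \<le> norm x"
    and selfadj: "cinner (T x) y = cinner x (T y)"
begin

lemma norm_sqrt_iter_le: "norm (sqrt_iter T k x) \<le> sqrt_bound k * norm x"
proof (induction k arbitrary: x)
  case (Suc k)
  have "norm (sqrt_iter T k (sqrt_iter T k x)) \<le> sqrt_bound k * (sqrt_bound k * norm x)"
    by (rule order_trans[OF Suc mult_left_mono[OF Suc sqrt_bound(1)]])
  then have "norm (T x + sqrt_iter T k (sqrt_iter T k x)) \<le> (1 + (sqrt_bound k)\<^sup>2) * norm x"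
    using norm_triangle_ineq[of "T x" "sqrt_iter T k (sqrt_iter T k x)"] norm_le[of x]
    by (simp add: power2_eq_square algebra_simps)
  then show ?case by (simp del: scaleR_add_right)
qed simp

lemma bounded_op_sqrt_iter: "bounded_op (sqrt_iter T k)"
proof (rule bounded_opI[OF _ _ norm_sqrt_iter_le])
  show "sqrt_iter T k (x + y) = sqrt_iter T k x + sqrt_iter T k y" for x y
    by (induction k arbitrary: x y) (simp_all add: bounded_op_add[OF bounded] scaleR_add_right)
  show "sqrt_iter T k (c *\<^sub>C x) = c *\<^sub>C sqrt_iter T k x" for c x
    by (induction k arbitrary: x)
      (simp_all add: bounded_op_scaleC[OF bounded] scaleC_add_right scaleR_scaleC scaleC_scaleC
        mult.commute)
qed

lemma selfadj_sqrt_iter: "cinner (sqrt_iter T k x) y = cinner x (sqrt_iter T k y)"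
  by (induction k arbitrary: x y)
    (simp_all add: scaleR_scaleC cinner_scaleC_left cinner_scaleC_right cinner_add_left
      cinner_add_right selfadj)

text \<open>With consecutive iterates \<open>Y\<close> and \<open>Y'\<close>, the difference of
  squares is \<open>(Y' - Y) Y' + Y (Y' - Y)\<close>. The scalar recursion obeys the same identity,
  so scalar increments dominate operator increments.\<close>

lemma norm_sqrt_iter_diff_le:
  "norm (sqrt_iter T (Suc k) x - sqrt_iter T k x) \<le> (sqrt_bound (Suc k) - sqrt_bound k) * norm x"
proof (induction k arbitrary: x)
  case 0
  show ?case using norm_le[of x] by simp
next
  case (Suc k)
  let ?Y = "sqrt_iter T k" and ?Y' = "sqrt_iter T (Suc k)"
  let ?c = "sqrt_bound k" and ?c' = "sqrt_bound (Suc k)"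
  have "norm (?Y' (?Y' x) - ?Y (?Y' x)) \<le> (?c' - ?c) * (?c' * norm x)"
    by (rule order_trans[OF Suc mult_left_mono[OF norm_sqrt_iter_le]]) (use sqrt_bound_mono in simp)
  moreover have "norm (?Y (?Y' x - ?Y x)) \<le> ?c * ((?c' - ?c) * norm x)"
    by (rule order_trans[OF norm_sqrt_iter_le mult_left_mono[OF Suc sqrt_bound(1)]])
  ultimately have "norm (?Y' (?Y' x) - ?Y (?Y' x) + ?Y (?Y' x - ?Y x)) \<le> (?c'\<^sup>2 - ?c\<^sup>2) * norm x"
    using norm_triangle_ineq[of "?Y' (?Y' x) - ?Y (?Y' x)" "?Y (?Y' x - ?Y x)"]
    by (simp add: power2_eq_square algebra_simps del: sqrt_iter.simps sqrt_bound.simps)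
  moreover have "sqrt_iter T (Suc (Suc k)) x - ?Y' x
      = (1 / 2) *\<^sub>R (?Y' (?Y' x) - ?Y (?Y' x) + ?Y (?Y' x - ?Y x))"
    unfolding bounded_op_diff[OF bounded_op_sqrt_iter] sqrt_iter.simps(2)[of T "Suc k"]
    by (simp add: algebra_simps)
  moreover have "sqrt_bound (Suc (Suc k)) - ?c' = (?c'\<^sup>2 - ?c\<^sup>2) / 2"
    by (simp add: field_simps)
  ultimately show ?case
    by (simp only: norm_scaleR)
qed

text \<open>The dominating scalar increments telescope along a bounded increasing sequence, so the
  operator increments are absolutely summable at each \<open>x\<close>.\<close>

lemma sqrt_iter_tendsto: "(\<lambda>k. sqrt_iter T k x) \<longlonglongrightarrow> id_minus_sqrt T x"
proof -
  have "incseq sqrt_bound" by (intro incseq_SucI sqrt_bound_mono)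
  then obtain L where "sqrt_bound \<longlonglongrightarrow> L"
    using incseq_convergent[of sqrt_bound 1] sqrt_bound(2) by blast
  from telescope_summable[OF this]
  have "summable (\<lambda>k. (sqrt_bound (Suc k) - sqrt_bound k) * norm x)"
    by (rule summable_mult2)
  then have "summable (\<lambda>k. sqrt_iter T (Suc k) x - sqrt_iter T k x)"
    by (rule summable_comparison_test') (rule norm_sqrt_iter_diff_le)
  then have "convergent (\<lambda>K. \<Sum>k<K. sqrt_iter T (Suc k) x - sqrt_iter T k x)"
    by (simp only: summable_iff_convergent)
  then have "convergent (\<lambda>k. sqrt_iter T k x)"
    unfolding sum_lessThan_telescope[of "\<lambda>k. sqrt_iter T k x"] by simp
  then show ?thesis
    unfolding id_minus_sqrt_def by (simp only: convergent_LIMSEQ_iff)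
qed

lemma norm_id_minus_sqrt_le: "norm (id_minus_sqrt T x) \<le> norm x"
proof (rule LIMSEQ_le_const2[OF tendsto_norm[OF sqrt_iter_tendsto]])
  show "\<exists>N. \<forall>k\<ge>N. norm (sqrt_iter T k x) \<le> norm x"
    using order_trans[OF norm_sqrt_iter_le mult_right_mono[OF sqrt_bound(2) norm_ge_zero]]
    by (metis mult_1)
qed

lemma bounded_op_id_minus_sqrt: "bounded_op (id_minus_sqrt T)"
proof (rule bounded_opI[where K = 1])
  show "id_minus_sqrt T (x + y) = id_minus_sqrt T x + id_minus_sqrt T y" for x y
    by (rule LIMSEQ_unique[OF sqrt_iter_tendsto])
      (unfold bounded_op_add[OF bounded_op_sqrt_iter], intro tendsto_add sqrt_iter_tendsto)
  show "id_minus_sqrt T (c *\<^sub>C x) = c *\<^sub>C id_minus_sqrt T x" for c x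
    by (rule LIMSEQ_unique[OF sqrt_iter_tendsto])
      (unfold bounded_op_scaleC[OF bounded_op_sqrt_iter],
        intro bounded_linear.tendsto[OF bounded_linear_scaleC] sqrt_iter_tendsto)
qed (simp add: norm_id_minus_sqrt_le)

lemma selfadj_id_minus_sqrt: "cinner (id_minus_sqrt T x) y = cinner x (id_minus_sqrt T y)"
  by (rule LIMSEQ_unique[OF tendsto_cinner[OF sqrt_iter_tendsto tendsto_const]])
    (unfold selfadj_sqrt_iter, intro tendsto_cinner sqrt_iter_tendsto tendsto_const)

lemma id_minus_sqrt_fixpoint:
  "2 *\<^sub>R id_minus_sqrt T x = T x + id_minus_sqrt T (id_minus_sqrt T x)"
proof -
  let ?Y = "id_minus_sqrt T"
  \<comment> \<open>Both the operator and its argument vary with \<open>k\<close>. The error in the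
    argument is split off; it vanishes because all iterates have norm at most 1.\<close>
  have "(\<lambda>k. sqrt_iter T k (sqrt_iter T k x - ?Y x) + sqrt_iter T k (?Y x)) \<longlonglongrightarrow> 0 + ?Y (?Y x)"
  proof (intro tendsto_add sqrt_iter_tendsto)
    show "(\<lambda>k. sqrt_iter T k (sqrt_iter T k x - ?Y x)) \<longlonglongrightarrow> 0"
    proof (rule Lim_null_comparison)
      have "norm (sqrt_iter T k y) \<le> norm y" for k y
        using order_trans[OF norm_sqrt_iter_le mult_right_mono[OF sqrt_bound(2) norm_ge_zero]]
        by (metis mult_1)
      then show "\<forall>\<^sub>F k in sequentially. norm (sqrt_iter T k (sqrt_iter T k x - ?Y x))
          \<le> norm (sqrt_iter T k x - ?Y x)"
        by simp
      show "(\<lambda>k. norm (sqrt_iter T k x - ?Y x)) \<longlonglongrightarrow> 0"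
        by (intro tendsto_norm_zero LIM_zero sqrt_iter_tendsto)
    qed
  qed
  then have "(\<lambda>k. sqrt_iter T k (sqrt_iter T k x)) \<longlonglongrightarrow> ?Y (?Y x)"
    by (simp add: bounded_op_diff[OF bounded_op_sqrt_iter])
  then have "(\<lambda>k. sqrt_iter T (Suc k) x) \<longlonglongrightarrow> (1 / 2) *\<^sub>R (T x + ?Y (?Y x))"
    unfolding sqrt_iter.simps by (intro tendsto_intros)
  then have "?Y x = (1 / 2) *\<^sub>R (T x + ?Y (?Y x))"
    by (rule LIMSEQ_unique[OF LIMSEQ_Suc[OF sqrt_iter_tendsto]])
  then have "2 *\<^sub>R ?Y x = 2 *\<^sub>R (1 / 2) *\<^sub>R (T x + ?Y (?Y x))"
    by (rule arg_cong)
  then show ?thesis by simp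
qed

text \<open>Expanding the square of \<open>I - Y\<close> and inserting the fixed point equation
  leaves \<open>I - T\<close>. Positivity holds because \<open>Y\<close> is a selfadjoint
  contraction.\<close>

lemma op_sqrt_exists:
  defines "Q \<equiv> \<lambda>x. x - id_minus_sqrt T x"
  shows "bounded_op Q" "cinner (Q x) x \<in> \<real>\<^sub>\<ge>\<^sub>0" "Q (Q x) = x - T x"
    "cinner (Q x) y = cinner x (Q y)"
proof -
  note Y = bounded_op_id_minus_sqrt
  show "bounded_op Q"
  proof (rule bounded_opI)
    show "norm (Q x) \<le> 2 * norm x" for x
      using norm_triangle_ineq4[of x "id_minus_sqrt T x"] norm_id_minus_sqrt_le[of x]
      by (simp add: Q_def)
  qed (simp_all add: Q_def bounded_op_linear[OF Y] scaleC_diff_right)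
  show sa: "cinner (Q x) y = cinner x (Q y)" for x y
    by (simp add: Q_def cinner_diff_left cinner_diff_right selfadj_id_minus_sqrt)
  show "Q (Q x) = x - T x"
    using id_minus_sqrt_fixpoint[of x] by (simp add: Q_def bounded_op_diff[OF Y] scaleR_2 algebra_simps)
  have "cmod (cinner (id_minus_sqrt T x) x) \<le> norm x * norm x"
    using cinner_norm_le mult_right_mono[OF norm_id_minus_sqrt_le norm_ge_zero] order_trans by blast
  then have "Re (cinner (id_minus_sqrt T x) x) \<le> (norm x)\<^sup>2"
    unfolding power2_eq_square using complex_Re_le_cmod order_trans by blast
  moreover have "Im (cinner (Q x) x) = 0"
    using arg_cong[OF cinner_commute[of "Q x" x], of Im] sa[of x x] by simp
  ultimately show "cinner (Q x) x \<in> \<real>\<^sub>\<ge>\<^sub>0"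
    by (simp add: complex_nonneg_Reals_iff Q_def cinner_diff_left cinner_self del: of_real_power)
qed

end

text \<open>Polarisation: the form at \<open>x + y\<close> relates the imaginary parts, and
  replacing \<open>x\<close> by \<open>\<i> *\<^sub>C x\<close> turns this into the relation of the
  real parts.\<close>

lemma selfadj_of_quadratic_real:
  fixes R :: "'a::complex_inner_space \<Rightarrow> 'a"
  assumes R: "bounded_op R" and real: "\<And>x. Im (cinner (R x) x) = 0"
  shows "cinner (R x) y = cinner x (R y)"
proof -
  have 1: "Im (cinner (R x) y) = - Im (cinner (R y) x)" for x y
    using real[of "x + y"] real[of x] real[of y]
    by (simp add: bounded_op_linear[OF R] cinner_add_left cinner_add_right)
  have 2: "Re (cinner (R x) y) = Re (cinner (R y) x)" for x y
    using 1[of "\<i> *\<^sub>C x" y]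
    by (simp add: bounded_op_linear[OF R] cinner_scaleC_left cinner_scaleC_right)
  have "cinner (R x) y = cnj (cinner (R y) x)"
    using 1[of x y] 2[of x y] by (simp add: complex_eq_iff)
  then show ?thesis by (metis cinner_commute)
qed

text \<open>The nonnegative form of \<open>R\<close> is minimal at \<open>y\<close>, so its
  derivative there in the direction \<open>R y\<close> vanishes; that derivative is twice the
  squared norm of \<open>R y\<close>.\<close>

lemma positive_op_eq_zero:
  fixes R :: "'a::complex_inner_space \<Rightarrow> 'a"
  assumes R: "bounded_op R" and pos: "\<And>x. cinner (R x) x \<in> \<real>\<^sub>\<ge>\<^sub>0" and zero: "Re (cinner (R y) y) = 0"
  shows "R y = 0"
proof -
  have sa: "cinner (R x) y = cinner x (R y)" for x y
    using pos by (intro selfadj_of_quadratic_real[OF R]) (auto simp: complex_nonneg_Reals_iff)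
  have "0 \<le> 2 * t * (norm (R y))\<^sup>2 + t\<^sup>2 * Re (cinner (R (R y)) (R y))" for t
  proof -
    have "0 \<le> Re (cinner (R (y + t *\<^sub>R R y)) (y + t *\<^sub>R R y))"
      using pos by (simp add: complex_nonneg_Reals_iff)
    moreover have "Re (cinner (R (R y)) y) = (norm (R y))\<^sup>2" "Re (cinner (R y) (R y)) = (norm (R y))\<^sup>2"
      by (simp_all add: sa cinner_self)
    ultimately show ?thesis
      using zero by (simp add: bounded_op_linear[OF R] cinner_add_left cinner_add_right
          scaleR_scaleC cinner_scaleC_left cinner_scaleC_right power2_eq_square algebra_simps)
  qed
  moreover have "Re (cinner (R (R y)) (R y)) \<ge> 0"
    using pos by (simp add: complex_nonneg_Reals_iff)
  ultimately have "(norm (R y))\<^sup>2 = 0"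
    by (intro quadratic_nonneg_linear_zero)
  then show ?thesis by simp
qed

text \<open>The intertwining passes through every iterate and then to the limit. It serves both
  uniqueness of the root and the relation between the two defect operators.\<close>

lemma id_minus_sqrt_intertwine:
  assumes "selfadjoint_contraction T" "selfadjoint_contraction T'" and X: "bounded_op X"
    and eq: "\<And>x. X (T x) = T' (X x)"
  shows "X (id_minus_sqrt T x) = id_minus_sqrt T' (X x)"
proof -
  have iter: "X (sqrt_iter T k x) = sqrt_iter T' k (X x)" for k x
    by (induction k arbitrary: x) (simp_all add: bounded_op_linear[OF X] eq)
  have "(\<lambda>k. X (sqrt_iter T k x)) \<longlonglongrightarrow> X (id_minus_sqrt T x)"
    by (intro bounded_linear.tendsto[OF bounded_op_bounded_linear[OF X]]
        selfadjoint_contraction.sqrt_iter_tendsto assms)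
  then show ?thesis
    unfolding iter
    by (rule LIMSEQ_unique) (rule selfadjoint_contraction.sqrt_iter_tendsto[OF assms(2)])
qed

text \<open>Uniqueness: a second positive root \<open>R\<close> commutes with
  \<open>T = I - R\<^sup>2\<close>, hence with \<open>Q\<close>, so \<open>Q + R\<close> annihilates
  \<open>y = Q x - R x\<close>. By positivity \<open>Q y\<close> and \<open>R y\<close> both vanish,
  and then so does \<open>y\<close>, whose squared norm is the inner product of \<open>x\<close>
  with \<open>Q y - R y\<close>.\<close>

lemma (in selfadjoint_contraction) op_sqrt_eq:
  "op_sqrt (\<lambda>x. x - T x) = (\<lambda>x. x - id_minus_sqrt T x)"
  unfolding op_sqrt_def
proof (rule the_equality)
  define Q where "Q x = x - id_minus_sqrt T x" for x
  note Q = op_sqrt_exists[folded Q_def]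
  show "bounded_op (\<lambda>x. x - id_minus_sqrt T x) \<and>
      (\<forall>x. cinner (x - id_minus_sqrt T x) x \<in> \<real>\<^sub>\<ge>\<^sub>0) \<and>
      (\<forall>x. x - id_minus_sqrt T x - id_minus_sqrt T (x - id_minus_sqrt T x) = x - T x)"
    using op_sqrt_exists by blast
  fix R assume "bounded_op R \<and> (\<forall>x. cinner (R x) x \<in> \<real>\<^sub>\<ge>\<^sub>0) \<and> (\<forall>x. R (R x) = x - T x)"
  then have R: "bounded_op R" "\<And>x. cinner (R x) x \<in> \<real>\<^sub>\<ge>\<^sub>0" "\<And>x. R (R x) = x - T x"
    by auto
  have sa: "cinner (R x) y = cinner x (R y)" for x y
    using R(2) by (intro selfadj_of_quadratic_real[OF R(1)]) (auto simp: complex_nonneg_Reals_iff)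
  have "R (T x) = T (R x)" for x
    using R(3)[of "R x"] arg_cong[OF R(3)[of x], of R]
    by (simp add: bounded_op_linear[OF R(1)])
  from id_minus_sqrt_intertwine[OF selfadjoint_contraction_axioms selfadjoint_contraction_axioms R(1) this]
  have RQ: "R (Q x) = Q (R x)" for x
    by (simp add: Q_def bounded_op_linear[OF R(1)])
  have "Q x = R x" for x
  proof -
    define y where "y = Q x - R x"
    have "Q y + R y = 0"
      by (simp add: y_def bounded_op_linear[OF R(1)] bounded_op_linear[OF Q(1)] R(3) Q(3) RQ)
    then have "Re (cinner (Q y) y) + Re (cinner (R y) y) = 0"
      by (metis cinner_add_left cinner_zero_left plus_complex.sel(1) zero_complex.sel(1))
    moreover have "Re (cinner (Q y) y) \<ge> 0" "Re (cinner (R y) y) \<ge> 0"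
      using Q(2) R(2) by (auto simp: complex_nonneg_Reals_iff)
    ultimately have "Q y = 0" "R y = 0"
      by (intro positive_op_eq_zero Q R; linarith)+
    moreover have "cinner y y = cinner x (Q y - R y)"
      unfolding y_def cinner_diff_left[of "Q x" "R x"] sa Q(4) cinner_diff_right[of x] ..
    ultimately show ?thesis
      by (simp add: cinner_self y_def)
  qed
  then show "R = (\<lambda>x. x - id_minus_sqrt T x)"
    by (auto simp: Q_def)
qed


section \<open>Defect operators\<close>

lemma contraction_adj:
  fixes S :: "'a::complex_hilbert_space \<Rightarrow> 'a"
  shows "contraction S \<Longrightarrow> contraction (adj S)"
  using bounded_op_adj[of S 1] by (simp add: contraction_def)

lemma selfadjoint_contraction_adj_comp:
  fixes S :: "'a::complex_hilbert_space \<Rightarrow> 'a"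
  assumes "contraction S"
  shows "selfadjoint_contraction (\<lambda>x. adj S (S x))"
proof
  have S: "bounded_op S" and S': "bounded_op (adj S)"
    using assms contraction_adj[OF assms] by (simp_all add: contraction_def)
  show le: "norm (adj S (S x)) \<le> norm x" for x
    using assms contraction_adj[OF assms] unfolding contraction_def by (meson order_trans)
  show "bounded_op (\<lambda>x. adj S (S x))"
    using le by (intro bounded_opI[where K = 1]) (simp_all add: bounded_op_linear[OF S] bounded_op_linear[OF S'])
  show "cinner (adj S (S x)) y = cinner x (adj S (S y))" for x y
    by (simp add: cinner_adj_left[OF S] cinner_adj[OF S])
qed

lemma defect_op_props:
  fixes S :: "'a::complex_hilbert_space \<Rightarrow> 'a"
  assumes "contraction S"
  shows bounded_op_defect_op: "bounded_op (defect_op S)"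
    and defect_op_sq: "defect_op S (defect_op S x) = x - adj S (S x)"
    and selfadj_defect_op: "cinner (defect_op S x) y = cinner x (defect_op S y)"
proof -
  interpret selfadjoint_contraction "\<lambda>x. adj S (S x)"
    by (rule selfadjoint_contraction_adj_comp[OF assms])
  show "bounded_op (defect_op S)" "defect_op S (defect_op S x) = x - adj S (S x)"
    "cinner (defect_op S x) y = cinner x (defect_op S y)"
    unfolding defect_op_def op_sqrt_eq by (rule op_sqrt_exists)+
qed

lemma defect_op_intertwine:
  fixes S :: "'a::complex_hilbert_space \<Rightarrow> 'a"
  assumes "contraction S"
  shows "S (defect_op S x) = defect_op (adj S) (S x)"
proof -
  have S: "bounded_op S" using assms by (simp add: contraction_def)
  note pc = selfadjoint_contraction_adj_comp[OF assms]
    selfadjoint_contraction_adj_comp[OF contraction_adj[OF assms]]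
  have "S (id_minus_sqrt (\<lambda>x. adj S (S x)) x) = id_minus_sqrt (\<lambda>x. adj (adj S) (adj S x)) (S x)"
    by (rule id_minus_sqrt_intertwine[OF pc S]) (simp add: adj_adj[OF S])
  then show ?thesis
    unfolding defect_op_def selfadjoint_contraction.op_sqrt_eq[OF pc(1)]
      selfadjoint_contraction.op_sqrt_eq[OF pc(2)]
    by (simp add: bounded_op_linear[OF S])
qed

lemma complex_subspace_closure_range:
  assumes "bounded_op A"
  shows "complex_subspace (closure (range A))"
  unfolding complex_subspace_def
proof (intro conjI ballI allI)
  show "0 \<in> closure (range A)"
    using bounded_op_zero[OF assms] closure_subset by (metis rangeI subsetD)
  fix x assume "x \<in> closure (range A)"
  then obtain f where f: "\<And>k. f k \<in> range A" "f \<longlonglongrightarrow> x"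
    unfolding closure_sequential by blast
  {
    fix y assume "y \<in> closure (range A)"
    then obtain g where g: "\<And>k. g k \<in> range A" "g \<longlonglongrightarrow> y"
      unfolding closure_sequential by blast
    have "f k + g k \<in> range A" for k
    proof -
      obtain a b where "f k = A a" "g k = A b"
        using f(1)[of k] g(1)[of k] by blast
      then show ?thesis
        by (simp flip: bounded_op_add[OF assms])
    qed
    then show "x + y \<in> closure (range A)"
      by (intro closed_sequentially[OF closed_closure _ tendsto_add[OF f(2) g(2)]]
          subsetD[OF closure_subset])
  }
  fix c
  have "c *\<^sub>C f k \<in> range A" for k
  proof -
    obtain a where "f k = A a"
      using f(1)[of k] by blast
    then show ?thesis
      by (simp flip: bounded_op_scaleC[OF assms])
  qed
  then show "c *\<^sub>C x \<in> closure (range A)"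
    by (intro closed_sequentially[OF closed_closure _ bounded_linear.tendsto[OF bounded_linear_scaleC f(2)]]
        subsetD[OF closure_subset])
qed

lemma defect_space_subspace:
  fixes S :: "'a::complex_hilbert_space \<Rightarrow> 'a"
  assumes "contraction S"
  shows "complex_subspace (defect_space S)" "closed (defect_space S)"
  unfolding defect_space_def
  by (simp_all add: complex_subspace_closure_range bounded_op_defect_op assms)

lemma defect_op_in_space: "defect_op S x \<in> defect_space S"
  unfolding defect_space_def by (rule subsetD[OF closure_subset rangeI])


section \<open>The characteristic function as a transfer function\<close>

text \<open>With the states \<open>u\<close> and the outputs \<open>y\<close> given by \<open>char_state\<close> and \<open>char_output\<close>, the map
  \<open>(u k, g k) \<mapsto> (u (k + 1), y k)\<close> is unitary, and the transfer function from \<open>g\<close> to \<open>y\<close> is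
  the characteristic function of \<open>S\<close>.\<close>

primrec char_state :: "('a::complex_hilbert_space \<Rightarrow> 'a) \<Rightarrow> (nat \<Rightarrow> 'a) \<Rightarrow> nat \<Rightarrow> 'a" where
  "char_state S g 0 = 0"
| "char_state S g (Suc k) = adj S (char_state S g k) + defect_op S (g k)"

definition char_output :: "('a::complex_hilbert_space \<Rightarrow> 'a) \<Rightarrow> (nat \<Rightarrow> 'a) \<Rightarrow> nat \<Rightarrow> 'a"
  where "char_output S g k = defect_op (adj S) (char_state S g k) - S (g k)"

lemma hardy_eval_sums:
  "cmod z < 1 \<Longrightarrow> (\<lambda>k. z ^ k *\<^sub>C hardy_coeff f k) sums hardy_eval f z"
  using summable_sums[OF summable_disc_series[OF square_summable_hardy_coeff]]
  by (simp add: hardy_eval_conv_coeff disc_series_def)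

lemma hardy_cinner_sums:
  "(\<lambda>k. cinner (hardy_coeff f k) (hardy_coeff g k)) sums cinner f g"
  unfolding cinner_hardy_def by (intro summable_sums hardy_summable_cinner)

section \<open>Defect identities and energy balance of the colligation\<close>

locale hilbert_contraction =
  fixes S :: "'a::complex_hilbert_space \<Rightarrow> 'a"
  assumes contraction: "contraction S"
begin

lemma bounded: "bounded_op S"
  and bounded_adj: "bounded_op (adj S)"
  and norm_adj_le: "norm (adj S x) \<le> norm x"
  using contraction contraction_adj[OF contraction] by (simp_all add: contraction_def)

lemmas linear = bounded_op_linear[OF bounded] bounded_op_linear[OF bounded_adj]
  bounded_op_linear[OF bounded_op_defect_op[OF contraction]]
  bounded_op_linear[OF bounded_op_defect_op[OF contraction_adj[OF contraction]]]

lemma defect_adj_sq: "defect_op (adj S) (defect_op (adj S) x) = x - S (adj S x)"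
  using defect_op_sq[OF contraction_adj[OF contraction]] by (simp add: adj_adj[OF bounded])

lemma selfadj_defect_adj: "cinner (defect_op (adj S) x) y = cinner x (defect_op (adj S) y)"
  by (rule selfadj_defect_op[OF contraction_adj[OF contraction]])

lemma adj_defect_adj: "adj S (defect_op (adj S) x) = defect_op S (adj S x)"
  using defect_op_intertwine[OF contraction_adj[OF contraction]] by (simp add: adj_adj[OF bounded])

lemma cinner_defect: "cinner (defect_op S x) (defect_op S y) = cinner x y - cinner (S x) (S y)"
  by (simp add: selfadj_defect_op[OF contraction] defect_op_sq[OF contraction] cinner_diff_right
      cinner_adj[OF bounded])

lemma cinner_defect_adj:
  "cinner (defect_op (adj S) x) (defect_op (adj S) y) = cinner x y - cinner (adj S x) (adj S y)"
  by (simp add: selfadj_defect_adj defect_adj_sq cinner_diff_right cinner_adj_left[OF bounded])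

lemma norm_defect: "(norm (defect_op S x))\<^sup>2 = (norm x)\<^sup>2 - (norm (S x))\<^sup>2"
  using cinner_defect[of x x] unfolding cinner_self of_real_diff[symmetric] of_real_eq_iff .

lemma norm_defect_adj: "(norm (defect_op (adj S) x))\<^sup>2 = (norm x)\<^sup>2 - (norm (adj S x))\<^sup>2"
  using cinner_defect_adj[of x x] unfolding cinner_self of_real_diff[symmetric] of_real_eq_iff .

text \<open>By the intertwining of the defect operators the two cross terms agree and enter with
  opposite signs; the diagonal terms add up by the defect norm identities.\<close>

lemma colligation_isometry:
  "(norm (adj S u + defect_op S g))\<^sup>2 + (norm (defect_op (adj S) u - S g))\<^sup>2 = (norm u)\<^sup>2 + (norm g)\<^sup>2"
proof -
  have "cinner (defect_op (adj S) u) (S g) = cinner (adj S u) (defect_op S g)"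
    by (simp add: selfadj_defect_adj defect_op_intertwine[OF contraction, symmetric]
        cinner_adj_left[OF bounded])
  then show ?thesis
    by (simp add: norm_add_sq norm_diff_sq norm_defect norm_defect_adj)
qed

text \<open>The one-step balance summed up from the zero initial state. It bounds the states and
  makes the output square summable.\<close>

lemma char_output_energy:
  "(\<Sum>k<N. (norm (char_output S g k))\<^sup>2) + (norm (char_state S g N))\<^sup>2 = (\<Sum>k<N. (norm (g k))\<^sup>2)"
proof (induction N)
  case (Suc N)
  then show ?case
    using colligation_isometry[of "char_state S g N" "g N"] by (simp add: char_output_def)
qed simp

section \<open>The system driven by the Taylor coefficients of a Hardy function\<close>

context
  fixes f :: "'a hardy"
begin

lemma norm_char_state_le: "norm (char_state S (hardy_coeff f) k) \<le> norm f"
proof (rule power2_le_imp_le)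
  have "0 \<le> (\<Sum>j<k. (norm (char_output S (hardy_coeff f) j))\<^sup>2)"
    by (intro sum_nonneg) simp
  then show "(norm (char_state S (hardy_coeff f) k))\<^sup>2 \<le> (norm f)\<^sup>2"
    using char_output_energy[where g = "hardy_coeff f" and N = k] hardy_sum_le_norm[where f = f and K = k]
    by linarith
qed simp

lemma square_summable_char_output: "square_summable (char_output S (hardy_coeff f))"
  unfolding square_summable_def
proof (rule bounded_imp_summable)
  fix k
  show "(\<Sum>j\<le>k. (norm (char_output S (hardy_coeff f) j))\<^sup>2) \<le> (norm f)\<^sup>2"
    using char_output_energy[where g = "hardy_coeff f" and N = "Suc k"]
      hardy_sum_le_norm[where f = f and K = "Suc k"]
      zero_le_power2[of "norm (char_state S (hardy_coeff f) (Suc k))"]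
    unfolding lessThan_Suc_atMost by linarith
qed simp

lemma char_fun_eval:
  assumes z: "cmod z < 1"
  shows "(\<lambda>k. z ^ k *\<^sub>C char_output S (hardy_coeff f) k) sums char_fun S z (hardy_eval f z)"
proof -
  define u where "u = char_state S (hardy_coeff f)"
  define F where "F = hardy_eval f z"
  note z_linear = bounded_linear_scaleC[of z]
  have "summable (\<lambda>k. z ^ k *\<^sub>C u k)"
  proof (rule summable_comparison_test')
    show "summable (\<lambda>k. cmod z ^ k * norm f)"
      using z by (intro summable_mult2 summable_geometric) simp
    show "norm (z ^ k *\<^sub>C u k) \<le> cmod z ^ k * norm f" for k
      unfolding u_def by (simp add: norm_scaleC norm_power mult_left_mono norm_char_state_le)
  qed
  then obtain U where U: "(\<lambda>k. z ^ k *\<^sub>C u k) sums U"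
    unfolding summable_def by blast
  have f: "(\<lambda>k. z ^ k *\<^sub>C hardy_coeff f k) sums F"
    unfolding F_def by (rule hardy_eval_sums[OF z])
  have "(\<lambda>k. adj S (z ^ k *\<^sub>C u k) + defect_op S (z ^ k *\<^sub>C hardy_coeff f k)) sums
      (adj S U + defect_op S F)"
    by (intro sums_add bounded_linear.sums[OF _ U] bounded_linear.sums[OF _ f] linear)
  then have "(\<lambda>k. z *\<^sub>C (adj S (z ^ k *\<^sub>C u k) + defect_op S (z ^ k *\<^sub>C hardy_coeff f k))) sums
      (z *\<^sub>C (adj S U + defect_op S F))"
    by (rule bounded_linear.sums[OF z_linear])
  then have "(\<lambda>k. z ^ Suc k *\<^sub>C u (Suc k)) sums (z *\<^sub>C (adj S U + defect_op S F))"
    by (simp add: u_def linear scaleC_add_right scaleC_scaleC)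
  then have "(\<lambda>k. z ^ k *\<^sub>C u k) sums (z *\<^sub>C (adj S U + defect_op S F) + z ^ 0 *\<^sub>C u 0)"
    by (rule sums_Suc)
  from sums_unique2[OF this U] have U_eq: "U - z *\<^sub>C adj S U = z *\<^sub>C defect_op S F"
    by (simp add: u_def scaleC_add_right algebra_simps)
  \<comment> \<open>\<open>inv\<close> in \<open>char_fun\<close> only chooses a preimage;
    injectivity makes that choice \<open>U\<close>.\<close>
  have "inj (\<lambda>y. y - z *\<^sub>C adj S y)"
  proof (rule injI)
    fix x y assume "x - z *\<^sub>C adj S x = y - z *\<^sub>C adj S y"
    then have "x - y = z *\<^sub>C adj S (x - y)"
      by (simp add: linear scaleC_diff_right algebra_simps)
    then have "norm (x - y) \<le> cmod z * norm (x - y)"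
      by (metis norm_scaleC mult_left_mono norm_adj_le norm_ge_zero)
    then have "(1 - cmod z) * norm (x - y) \<le> 0"
      by (simp add: algebra_simps)
    then show "x = y"
      using z by (simp add: mult_le_0_iff)
  qed
  from inv_f_eq[OF this U_eq]
  have "char_fun S z F = defect_op (adj S) U - S F"
    by (simp add: char_fun_def)
  moreover have "(\<lambda>k. defect_op (adj S) (z ^ k *\<^sub>C u k) - S (z ^ k *\<^sub>C hardy_coeff f k)) sums
      (defect_op (adj S) U - S F)"
    by (intro sums_diff bounded_linear.sums[OF _ U] bounded_linear.sums[OF _ f] linear)
  ultimately show ?thesis
    by (simp add: char_output_def u_def F_def linear scaleC_diff_right)
qed

lemma hardy_coeff_char_mult:
  "hardy_coeff (hardy_mult (char_fun S) f) = char_output S (hardy_coeff f)"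
proof -
  have "hardy_mult (char_fun S) f = Abs_hardy (disc_series (char_output S (hardy_coeff f)))"
  proof (rule hardy_mult_eqI)
    fix z :: complex assume "cmod z < 1"
    then show "hardy_eval (Abs_hardy (disc_series (char_output S (hardy_coeff f)))) z
        = char_fun S z (hardy_eval f z)"
      using sums_unique[OF char_fun_eval]
      by (simp add: Abs_hardy_disc_series square_summable_char_output disc_series_def)
  qed
  then show ?thesis
    by (simp add: Abs_hardy_disc_series square_summable_char_output)
qed

end

end


section \<open>The model of a pure contraction\<close>

definition model_map :: "('a::complex_hilbert_space \<Rightarrow> 'a) \<Rightarrow> 'a \<Rightarrow> 'a hardy"
  where "model_map S x = Abs_hardy (disc_series (\<lambda>k. defect_op (adj S) ((adj S ^^ k) x)))"

text \<open>The adjoint of multiplication by \<open>z ^ l\<close>.\<close>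

definition backward_shift :: "nat \<Rightarrow> 'a::complex_hilbert_space hardy \<Rightarrow> 'a hardy"
  where "backward_shift l f = Abs_hardy (disc_series (\<lambda>k. hardy_coeff f (k + l)))"

lemma backward_shift:
  shows hardy_coeff_backward_shift: "hardy_coeff (backward_shift l f) k = hardy_coeff f (k + l)"
    and norm_backward_shift_le: "norm (backward_shift l f) \<le> norm f"
proof -
  have "square_summable (\<lambda>k. hardy_coeff f (k + l))"
    using hardy_summable[of f] summable_iff_shift[of "\<lambda>k. (norm (hardy_coeff f k))\<^sup>2" l]
    by (simp add: square_summable_def)
  then show coeff: "hardy_coeff (backward_shift l f) k = hardy_coeff f (k + l)" for k
    by (simp add: backward_shift_def Abs_hardy_disc_series)
  have "0 \<le> (\<Sum>k<l. (norm (hardy_coeff f k))\<^sup>2)" by (intro sum_nonneg) simp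
  then have "(norm (backward_shift l f))\<^sup>2 \<le> (norm f)\<^sup>2"
    unfolding hardy_norm_sq coeff suminf_split_initial_segment[OF hardy_summable[of f], of l] by simp
  then show "norm (backward_shift l f) \<le> norm f"
    by (rule power2_le_imp_le) simp
qed

section \<open>The isometric embedding of the space into the Hardy space\<close>

locale hilbert_pure_contraction =
  fixes S :: "'a::complex_hilbert_space \<Rightarrow> 'a"
  assumes pure: "pure_contraction S"
begin

sublocale hilbert_contraction S
  using pure by unfold_locales (simp add: pure_contraction_def)

lemma adj_power_tendsto: "(\<lambda>k. (adj S ^^ k) x) \<longlonglongrightarrow> 0"
  using pure by (simp add: pure_contraction_def)

lemma hardy_coeff_model_map: "hardy_coeff (model_map S x) k = defect_op (adj S) ((adj S ^^ k) x)"
proof -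
  have "(\<lambda>k. (norm ((adj S ^^ k) x))\<^sup>2) \<longlonglongrightarrow> (norm (0::'a))\<^sup>2"
    by (intro tendsto_power tendsto_norm adj_power_tendsto)
  from sums_summable[OF telescope_sums'[OF this]]
  have "square_summable (\<lambda>k. defect_op (adj S) ((adj S ^^ k) x))"
    by (simp add: square_summable_def norm_defect_adj)
  then show ?thesis
    by (simp add: model_map_def Abs_hardy_disc_series)
qed

lemma model_map_in_hardy_space: "model_map S x \<in> hardy_space (defect_space (adj S))"
  by (simp add: hardy_space_def hardy_coeff_model_map defect_op_in_space)

lemma adj_power_linear:
  "(adj S ^^ k) (x + y) = (adj S ^^ k) x + (adj S ^^ k) y"
  "(adj S ^^ k) (x - y) = (adj S ^^ k) x - (adj S ^^ k) y"
  "(adj S ^^ k) (c *\<^sub>C x) = c *\<^sub>C (adj S ^^ k) x"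
  by (induction k) (simp_all add: linear)

lemma model_map_linear: "linear_map_on UNIV (model_map S)"
  and model_map_diff: "model_map S (x - y) = model_map S x - model_map S y"
  by (auto simp: linear_map_on_def hardy_coeff_model_map hardy_coeff_simps adj_power_linear linear
      intro!: hardy_eqI)

text \<open>The coefficientwise inner products are consecutive differences of the inner products of
  \<open>(adj S ^^ k) x\<close> and \<open>(adj S ^^ k) y\<close>; purity sends the tail to
  0.\<close>

lemma model_map_isometry: "cinner (model_map S x) (model_map S y) = cinner x y"
proof -
  have "(\<lambda>k. cinner ((adj S ^^ k) x) ((adj S ^^ k) y)) \<longlonglongrightarrow> cinner 0 (0::'a)"
    by (intro tendsto_cinner adj_power_tendsto)
  from telescope_sums'[OF this]
  have "(\<lambda>k. cinner (hardy_coeff (model_map S x) k) (hardy_coeff (model_map S y) k)) sums cinner x y"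
    by (simp add: hardy_coeff_model_map cinner_defect_adj)
  then show ?thesis
    by (rule sums_unique2[OF hardy_cinner_sums])
qed

lemma norm_model_map: "norm (model_map S x) = norm x"
  using model_map_isometry[of x x] by (simp add: norm_eq_sqrt_cinner)

text \<open>The inner product telescopes again: the initial term vanishes because the initial state
  is 0, the tail because states are bounded and \<open>S\<close> is pure.\<close>

lemma model_map_orthogonal: "cinner (model_map S x) (hardy_mult (char_fun S) g) = 0"
proof -
  define u where "u = char_state S (hardy_coeff g)"
  have "cinner (defect_op (adj S) ((adj S ^^ k) x)) (char_output S (hardy_coeff g) k)
      = cinner ((adj S ^^ k) x) (u k) - cinner ((adj S ^^ Suc k) x) (u (Suc k))" for k
  proof -
    have "cinner (defect_op (adj S) ((adj S ^^ k) x)) (S (hardy_coeff g k))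
        = cinner (adj S ((adj S ^^ k) x)) (defect_op S (hardy_coeff g k))"
      by (simp add: cinner_adj_left[OF bounded, symmetric] adj_defect_adj selfadj_defect_op[OF contraction])
    then show ?thesis
      by (simp add: char_output_def u_def cinner_diff_right cinner_add_right cinner_defect_adj)
  qed
  moreover have "(\<lambda>k. cinner ((adj S ^^ k) x) (u k)) \<longlonglongrightarrow> 0"
  proof (rule Lim_null_comparison)
    have "cmod (cinner ((adj S ^^ k) x) (u k)) \<le> norm ((adj S ^^ k) x) * norm g" for k
      using cinner_norm_le mult_left_mono[OF norm_char_state_le norm_ge_zero] order_trans
      unfolding u_def by blast
    then show "\<forall>\<^sub>F k in sequentially. norm (cinner ((adj S ^^ k) x) (u k))
        \<le> norm ((adj S ^^ k) x) * norm g"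
      by simp
    have "(\<lambda>k. norm ((adj S ^^ k) x) * norm g) \<longlonglongrightarrow> 0 * norm g"
      by (intro tendsto_mult tendsto_const tendsto_norm_zero adj_power_tendsto)
    then show "(\<lambda>k. norm ((adj S ^^ k) x) * norm g) \<longlonglongrightarrow> 0" by simp
  qed
  ultimately have "(\<lambda>k. cinner (hardy_coeff (model_map S x) k)
      (hardy_coeff (hardy_mult (char_fun S) g) k)) sums 0"
    using telescope_sums'[of "\<lambda>k. cinner ((adj S ^^ k) x) (u k)" 0]
    by (simp add: hardy_coeff_model_map hardy_coeff_char_mult u_def)
  then show ?thesis
    by (rule sums_unique2[OF hardy_cinner_sums])
qed

text \<open>On the range of \<open>defect_op (adj S)\<close> this is the intertwining relation;
  continuity extends it to the closure. It keeps the input recovered below inside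
  \<open>defect_space S\<close>.\<close>

lemma adj_defect_space:
  assumes "x \<in> defect_space (adj S)"
  shows "adj S x \<in> defect_space S"
proof -
  have "adj S ` closure (range (defect_op (adj S))) \<subseteq> closure (range (defect_op S))"
  proof (rule image_closure_subset)
    show "continuous_on (closure (range (defect_op (adj S)))) (adj S)"
      by (intro linear_continuous_on linear)
    show "adj S ` range (defect_op (adj S)) \<subseteq> closure (range (defect_op S))"
      using closure_subset[of "range (defect_op S)"] by (auto simp: adj_defect_adj)
  qed simp
  then show ?thesis
    using assms unfolding defect_space_def by blast
qed

text \<open>Run the unitary system backwards from the output \<open>f\<close>: the state \<open>u k\<close> is the adjoint of
  \<open>model_map S\<close> applied to the \<open>k\<close>-th backward shift of \<open>f\<close>.\<close>

lemma hardy_space_decomposition: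
  assumes f: "f \<in> hardy_space (defect_space (adj S))"
  obtains x g where "g \<in> hardy_space (defect_space S)"
    "f = model_map S x + hardy_mult (char_fun S) g"
proof -
  \<comment> \<open>\<open>adjoint_on\<close> is for maps of a space to itself, so the adjoint of
    \<open>model_map S\<close> is obtained directly from Riesz.\<close>
  have riesz: "\<exists>w\<in>UNIV. \<forall>x\<in>UNIV. cinner (model_map S x) (backward_shift k f) = cinner x w" for k
  proof (rule riesz_representation)
    show "cmod (cinner (model_map S x) (backward_shift k f)) \<le> norm (backward_shift k f) * norm x" for x
      using cinner_norm_le[of "model_map S x" "backward_shift k f"] by (simp add: norm_model_map mult.commute)
  qed (use model_map_linear in \<open>auto simp: linear_map_on_def cinner_add_left cinner_scaleC_left\<close>)
  have "\<exists>u. \<forall>k x. cinner (model_map S x) (backward_shift k f) = cinner x (u k)"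
    by (rule choice) (use riesz in blast)
  then obtain u where u: "\<And>k x. cinner (model_map S x) (backward_shift k f) = cinner x (u k)"
    by blast
  have norm_u: "norm (u k) \<le> norm f" for k
  proof (cases "u k = 0")
    case False
    have "(norm (u k))\<^sup>2 = cmod (cinner (model_map S (u k)) (backward_shift k f))"
      by (simp add: u cinner_self norm_power)
    also have "\<dots> \<le> norm (u k) * norm f"
      using cinner_norm_le[of "model_map S (u k)" "backward_shift k f"]
        mult_left_mono[OF norm_backward_shift_le norm_ge_zero[of "u k"]]
      by (force simp: norm_model_map intro: order_trans)
    finally show ?thesis
      using False by (simp add: power2_eq_square)
  qed simp
  \<comment> \<open>The zeroth coefficient is split off the series of inner products; the remaining
    series belongs to \<open>adj S x\<close> and the next backward shift.\<close>
  have u_rec: "u k = defect_op (adj S) (hardy_coeff f k) + S (u (Suc k))" for k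
  proof (rule cinner_ext_right)
    fix x
    let ?c = "\<lambda>j. cinner (defect_op (adj S) ((adj S ^^ j) x)) (hardy_coeff f (j + k))"
    have "?c sums cinner x (u k)"
      using hardy_cinner_sums[of "model_map S x" "backward_shift k f"]
      by (simp add: hardy_coeff_model_map hardy_coeff_backward_shift u)
    moreover have "(\<lambda>j. ?c (Suc j)) sums cinner (adj S x) (u (Suc k))"
      using hardy_cinner_sums[of "model_map S (adj S x)" "backward_shift (Suc k) f"]
      by (simp add: hardy_coeff_model_map hardy_coeff_backward_shift u funpow_swap1)
    from sums_Suc[OF this]
    have "?c sums (cinner (adj S x) (u (Suc k)) + ?c 0)" .
    ultimately have "cinner x (u k) = cinner (adj S x) (u (Suc k)) + ?c 0"
      by (rule sums_unique2)
    then show "cinner x (u k) = cinner x (defect_op (adj S) (hardy_coeff f k) + S (u (Suc k)))"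
      by (simp add: cinner_add_right selfadj_defect_adj cinner_adj_left[OF bounded])
  qed
  \<comment> \<open>The input component of the inverse colligation applied to the next state
    \<open>u (Suc k)\<close> and the output \<open>hardy_coeff f k\<close>; \<open>state\<close> and
    \<open>out\<close> check the inversion.\<close>
  define g where "g k = defect_op S (u (Suc k)) - adj S (hardy_coeff f k)" for k
  have state: "u (Suc k) = adj S (u k) + defect_op S (g k)" for k
    by (simp add: u_rec[of k] g_def linear adj_defect_adj defect_op_sq[OF contraction])
  have out: "hardy_coeff f k = defect_op (adj S) (u k) - S (g k)" for k
    by (simp add: u_rec[of k] g_def linear defect_adj_sq defect_op_intertwine[OF contraction])
  have "(\<Sum>k<N. (norm (g k))\<^sup>2) + (norm (u 0))\<^sup>2
      = (\<Sum>k<N. (norm (hardy_coeff f k))\<^sup>2) + (norm (u N))\<^sup>2" for N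
  proof (induction N)
    case (Suc N)
    then show ?case
      using colligation_isometry[of "u N" "g N"] by (simp flip: state out)
  qed simp
  then have energy: "(\<Sum>k<N. (norm (g k))\<^sup>2) \<le> (norm f)\<^sup>2 + (norm f)\<^sup>2" for N
    using hardy_sum_le_norm[where f = f and K = N] power_mono[OF norm_u norm_ge_zero, of N 2]
      zero_le_power2[of "norm (u 0)"]
    by (smt (verit))
  have "square_summable g"
    unfolding square_summable_def
    by (rule bounded_imp_summable[where B = "(norm f)\<^sup>2 + (norm f)\<^sup>2"])
      (use energy[of "Suc _"] in \<open>simp_all add: lessThan_Suc_atMost\<close>)
  then obtain G where G: "hardy_coeff G = g"
    by (metis Abs_hardy_disc_series(2))
  \<comment> \<open>Superposition: the response to the input from state 0 plus the free evolution of
    \<open>u 0\<close>. The first yields the multiple of the characteristic function, the second the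
    image of \<open>model_map S\<close>.\<close>
  have u_eq: "u k = char_state S g k + (adj S ^^ k) (u 0)" for k
    by (induction k) (simp_all add: state linear)
  have "hardy_coeff f k = char_output S g k + defect_op (adj S) ((adj S ^^ k) (u 0))" for k
    unfolding out[of k] u_eq[of k] by (simp add: char_output_def linear)
  then have "f = model_map S (u 0) + hardy_mult (char_fun S) G"
    by (intro hardy_eqI)
      (simp add: hardy_coeff_simps hardy_coeff_model_map hardy_coeff_char_mult G)
  moreover have "G \<in> hardy_space (defect_space S)"
    using f unfolding hardy_space_def
    by (auto simp: G g_def intro!: complex_subspace_diff defect_space_subspace contraction
        defect_op_in_space adj_defect_space)
  ultimately show ?thesis by (rule that[rotated])
qed

text \<open>For the reverse inclusion, decompose \<open>f\<close>: its second summand is orthogonal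
  to \<open>f\<close> and to the first summand, hence to itself, so it is 0.\<close>

lemma range_model_map: "range (model_map S) = char_model_space S"
proof
  show "range (model_map S) \<subseteq> char_model_space S"
    by (auto simp: char_model_space_def orth_diff_def model_map_in_hardy_space model_map_orthogonal)
  show "char_model_space S \<subseteq> range (model_map S)"
  proof
    fix f assume f: "f \<in> char_model_space S"
    then have "f \<in> hardy_space (defect_space (adj S))"
      by (simp add: char_model_space_def orth_diff_def)
    then obtain x g where g: "g \<in> hardy_space (defect_space S)"
      and f_eq: "f = model_map S x + hardy_mult (char_fun S) g"
      by (rule hardy_space_decomposition)
    let ?h = "hardy_mult (char_fun S) g"
    have "cinner f ?h = 0"
      using f g by (auto simp: char_model_space_def orth_diff_def)
    then have "cinner ?h ?h = 0"
      unfolding f_eq cinner_add_left model_map_orthogonal by simp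
    then show "f \<in> range (model_map S)"
      by (simp add: f_eq cinner_self)
  qed
qed

text \<open>The hypothesis on \<open>F\<close> is the weak form of \<open>F* W = W R*\<close> with
  \<open>W = model_map S\<close>. It makes \<open>F (W x) - W (R x)\<close> orthogonal to the range
  of \<open>W\<close>, so projecting \<open>F (W x)\<close> gives \<open>W (R x)\<close>.\<close>

lemma unitarily_equivalent_compression:
  assumes R: "bounded_op R"
    and F: "\<And>x y. cinner (F (model_map S x)) (model_map S y) = cinner (model_map S x) (model_map S (adj R y))"
  shows "unitarily_equivalent UNIV R (char_model_space S) (\<lambda>f. orth_proj (char_model_space S) (F f))"
  unfolding unitarily_equivalent_def
proof (intro exI[of _ "model_map S"] conjI ballI)
  fix x
  let ?f = "F (model_map S x)"
  have orth: "cinner (?f - model_map S (R x)) w = 0" if "w \<in> char_model_space S" for w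
  proof -
    obtain y where "w = model_map S y"
      using \<open>w \<in> char_model_space S\<close> unfolding range_model_map[symmetric] by blast
    then show ?thesis
      by (simp add: cinner_diff_left F model_map_isometry cinner_adj[OF R])
  qed
  have in_H: "model_map S (R x) \<in> char_model_space S"
    unfolding range_model_map[symmetric] by simp
  have "orth_proj (char_model_space S) ?f = model_map S (R x)"
    unfolding orth_proj_def
  proof (rule the_equality)
    fix v assume v: "v \<in> char_model_space S \<and> (\<forall>w\<in>char_model_space S. cinner (?f - v) w = 0)"
    then obtain y where y: "v = model_map S y"
      unfolding range_model_map[symmetric] by blast
    have "v - model_map S (R x) \<in> char_model_space S"
      unfolding y model_map_diff[symmetric] range_model_map[symmetric] by simp
    with v orth have "cinner ((?f - model_map S (R x)) - (?f - v)) (v - model_map S (R x)) = 0"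
      unfolding cinner_diff_left[of "?f - model_map S (R x)"] by simp
    then show "v = model_map S (R x)"
      by (simp add: cinner_self)
  qed (use orth in_H in blast)
  then show "model_map S (R x) = orth_proj (char_model_space S) (F (model_map S x))" ..
qed (use model_map_linear model_map_isometry range_model_map in auto)

end


section \<open>Coefficients of \<open>M\<^sub>z\<^sup>l \<otimes> A\<close>\<close>

text \<open>\<open>A\<close> is controlled only on \<open>E\<close>, so partial sums, limit and
  differences are all kept in \<open>E\<close>.\<close>

lemma bounded_op_on_sums:
  assumes E: "complex_subspace E" "closed E" and A: "bounded_op_on E A"
    and a: "\<And>k. a k \<in> E" "a sums s"
  shows "(\<lambda>k. A (a k)) sums A s"
proof -
  obtain K where K: "\<And>x. x \<in> E \<Longrightarrow> norm (A x) \<le> K * norm x"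
    using bounded_op_on_bound[OF A] by blast
  have A_add: "A (x + y) = A x + A y" if "x \<in> E" "y \<in> E" for x y
    using A that by (simp add: bounded_op_on_def linear_map_on_def)
  have zero: "0 \<in> E" using E(1) by (simp add: complex_subspace_def)
  have A0: "A 0 = 0"
    using bounded_op_on_diff[OF A E(1) zero zero] by simp
  have partial: "(\<Sum>k<N. a k) \<in> E \<and> A (\<Sum>k<N. a k) = (\<Sum>k<N. A (a k))" for N
    using a(1) E(1) by (induction N) (auto simp: complex_subspace_def A0 A_add)
  have lim: "(\<lambda>N. \<Sum>k<N. a k) \<longlonglongrightarrow> s"
    using a(2) by (simp add: sums_def)
  have s: "s \<in> E"
    using partial by (intro closed_sequentially[OF E(2) _ lim]) blast
  have "(\<lambda>N. A (\<Sum>k<N. a k)) \<longlonglongrightarrow> A s"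
  proof (rule Lim_null_comparison[THEN LIM_zero_cancel])
    show "\<forall>\<^sub>F N in sequentially. norm (A (\<Sum>k<N. a k) - A s) \<le> K * norm ((\<Sum>k<N. a k) - s)"
      using partial s K complex_subspace_diff[OF E(1)]
      by (intro always_eventually allI) (metis bounded_op_on_diff[OF A E(1)])
    have "(\<lambda>N. K * norm ((\<Sum>k<N. a k) - s)) \<longlonglongrightarrow> K * 0"
      by (intro tendsto_mult tendsto_const tendsto_norm_zero LIM_zero lim)
    then show "(\<lambda>N. K * norm ((\<Sum>k<N. a k) - s)) \<longlonglongrightarrow> 0" by simp
  qed
  then show ?thesis
    using partial by (simp add: sums_def)
qed

text \<open>Both sides define the same function on the disc, and Taylor coefficients are determined
  by that function.\<close>

lemma hardy_coeff_tensor_op: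
  assumes E: "complex_subspace E" "closed E" and A: "bounded_op_on E A"
    and f: "f \<in> hardy_space E"
  shows "hardy_coeff (tensor_op E (M_z ^^ l) A f) = shift_coeff l (\<lambda>k. A (hardy_coeff f k))"
proof -
  obtain K where K: "\<And>x. x \<in> E \<Longrightarrow> norm (A x) \<le> K * norm x"
    using bounded_op_on_bound[OF A] by blast
  have fE: "hardy_coeff f k \<in> E" for k
    using f by (simp add: hardy_space_def)
  define b where "b k = A (hardy_coeff f k)" for k
  have b: "square_summable b"
    unfolding square_summable_def
  proof (rule summable_comparison_test')
    show "summable (\<lambda>k. K\<^sup>2 * (norm (hardy_coeff f k))\<^sup>2)"
      by (intro summable_mult hardy_summable)
    show "norm ((norm (b k))\<^sup>2) \<le> K\<^sup>2 * (norm (hardy_coeff f k))\<^sup>2" for k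
      using power_mono[OF K[OF fE[of k]], of 2] by (simp add: b_def power_mult_distrib)
  qed
  have "tensor_op E (M_z ^^ l) A f = Abs_hardy (disc_series (shift_coeff l b))"
  proof (rule hardy_eval_eqI)
    fix z :: complex assume z: "cmod z < 1"
    have "(\<lambda>k. A (z ^ k *\<^sub>C hardy_coeff f k)) sums A (hardy_eval f z)"
      using E(1) fE by (intro bounded_op_on_sums[OF E A] hardy_eval_sums z) (simp add: complex_subspace_def)
    then have "A (hardy_eval f z) = disc_series b z"
      using A fE z by (simp add: bounded_op_on_def linear_map_on_def disc_series_def b_def sums_unique)
    then show "hardy_eval (tensor_op E (M_z ^^ l) A f) z
        = hardy_eval (Abs_hardy (disc_series (shift_coeff l b))) z"
      by (simp add: tensor_op_M_z(3)[OF E A f] Abs_hardy_disc_series shift_coeff_norm b disc_series_shift)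
  qed
  then have "hardy_coeff (tensor_op E (M_z ^^ l) A f) = shift_coeff l b"
    by (simp add: Abs_hardy_disc_series shift_coeff_norm b)
  then show ?thesis
    unfolding b_def[abs_def] .
qed

text \<open>The adjoint of the tensor operator in coefficients: the first \<open>l\<close> terms of
  the inner product vanish, and reindexing moves the shift to \<open>g\<close> while
  \<open>A\<close> moves over as its adjoint on \<open>E\<close>.\<close>

lemma cinner_tensor_op_sums:
  assumes E: "complex_subspace E" "closed E" and A: "bounded_op_on E A"
    and f: "f \<in> hardy_space E"
  shows "(\<lambda>k. cinner (hardy_coeff f k) (adjoint_on E A (hardy_coeff g (k + l)))) sums
    cinner (tensor_op E (M_z ^^ l) A f) g"
proof -
  let ?c = "\<lambda>k. cinner (shift_coeff l (\<lambda>k. A (hardy_coeff f k)) k) (hardy_coeff g k)"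
  have "?c sums cinner (tensor_op E (M_z ^^ l) A f) g"
    using hardy_cinner_sums[of "tensor_op E (M_z ^^ l) A f" g]
    unfolding hardy_coeff_tensor_op[OF E A f] .
  then have "(\<lambda>k. ?c (k + l)) sums cinner (tensor_op E (M_z ^^ l) A f) g"
    by (subst sums_zero_iff_shift) (simp_all add: shift_coeff_def)
  moreover have "?c (k + l) = cinner (hardy_coeff f k) (adjoint_on E A (hardy_coeff g (k + l)))" for k
    using f by (simp add: shift_coeff_def hardy_space_def cinner_adjoint_on[OF E A])
  ultimately show ?thesis by simp
qed

lemma cinner_sum_left: "cinner (\<Sum>i\<in>I. f i) y = (\<Sum>i\<in>I. cinner (f i) (y::'a::complex_inner_space))"
  by (induction I rule: infinite_finite_induct) (simp_all add: cinner_add_left)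

lemma cinner_sum_right: "cinner x (\<Sum>i\<in>I. f i) = (\<Sum>i\<in>I. cinner x (f i :: 'a::complex_inner_space))"
  by (induction I rule: infinite_finite_induct) (simp_all add: cinner_add_right)

text \<open>Makes the shift the case \<open>l = 1\<close>, \<open>A = id\<close> of the coefficient
  formula.\<close>

lemma adjoint_on_id: "y \<in> M \<Longrightarrow> complex_subspace M \<Longrightarrow> adjoint_on M id y = y"
  unfolding adjoint_on_def
proof (rule the_equality)
  fix w assume "y \<in> M" "complex_subspace M" and w: "w \<in> M \<and> (\<forall>x\<in>M. cinner (id x) y = cinner x w)"
  then have "cinner (w - y) (w - y) = 0"
    using complex_subspace_diff[of M w y] by (simp add: cinner_diff_right)
  then show "w = y" by (simp add: cinner_self)
qed simp

section \<open>The two unitary equivalences\<close>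

theorem theorem3p6:
  fixes n m p :: nat
    and T :: "nat \<Rightarrow> 'a::complex_hilbert_space \<Rightarrow> 'a"
    and A :: "nat \<Rightarrow> nat \<Rightarrow> 'a \<Rightarrow> 'a"
  defines "E \<equiv> defect_space (adj (T n))"
    and "H \<equiv> char_model_space (T n)"
  assumes "n > 0" and "m > 0" and "p > 0" and "p dvd m"
    and "pure_Theta_contraction n m p T"
    and "\<And>l i. l \<le> p \<Longrightarrow> i \<in> {1..n - 1} \<Longrightarrow> bounded_op_on E (A l i)"
    and "\<And>l i x. l \<le> p \<Longrightarrow> i \<in> {1..n - 1} \<Longrightarrow> x \<in> E \<Longrightarrow>
      A l i x = adjoint_on E (A (p - l) (n - i)) x"
    and "\<And>i x. i \<in> {1..n - 1} \<Longrightarrow>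
      defect_op (adj (T n)) (adj (T i) x) =
        (\<Sum>l=0..p. adjoint_on E (A l i) (defect_op (adj (T n)) ((adj (T n) ^^ l) x)))"
  shows "(\<forall>i\<in>{1..n - 1}. unitarily_equivalent UNIV (T i) H
        (\<lambda>f. orth_proj H (\<Sum>l=0..p. tensor_op E (M_z ^^ l) (A l i) f))) \<and>
      unitarily_equivalent UNIV (T n) H (\<lambda>f. orth_proj H (tensor_op E M_z id f))"
proof -
  note A_bounded = assms(8) and A_eq = assms(10)
  have T: "bounded_op (T i)" "T i \<circ> T j = T j \<circ> T i" if "i \<in> {1..n}" "j \<in> {1..n}" for i j
    using assms(7) that by (auto simp: pure_Theta_contraction_def Theta_contraction_def)
  interpret hilbert_pure_contraction "T n"
    using assms(7) by unfold_locales (simp add: pure_Theta_contraction_def)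
  let ?W = "model_map (T n)" and ?S' = "adj (T n)"
  have E: "complex_subspace E" "closed E"
    unfolding E_def by (rule defect_space_subspace[OF contraction_adj[OF contraction]])+
  have W_in: "?W x \<in> hardy_space E" for x
    unfolding E_def by (rule model_map_in_hardy_space)
  show ?thesis
  proof (intro conjI ballI)
    fix i assume i: "i \<in> {1..n - 1}"
    then have i': "i \<in> {1..n}" "n \<in> {1..n}" by auto
    \<comment> \<open>Needed to move the adjoint of \<open>T i\<close> past the powers of
      \<open>?S'\<close> in the coefficients of \<open>?W (adj (T i) y)\<close>.\<close>
    have commute: "(?S' ^^ k) (adj (T i) y) = adj (T i) ((?S' ^^ k) y)" for k y
      by (induction k) (simp_all add: adj_commute[OF T(1)[OF i'(2) i'(1)] T(1)[OF i'] T(2)[OF i'(2) i'(1)]])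
    show "unitarily_equivalent UNIV (T i) H
        (\<lambda>f. orth_proj H (\<Sum>l=0..p. tensor_op E (M_z ^^ l) (A l i) f))"
      unfolding H_def
    proof (rule unitarily_equivalent_compression[OF T(1)[OF i']])
      fix x y
      have "(\<lambda>k. \<Sum>l=0..p. cinner (hardy_coeff (?W x) k)
            (adjoint_on E (A l i) (hardy_coeff (?W y) (k + l)))) sums
          (\<Sum>l=0..p. cinner (tensor_op E (M_z ^^ l) (A l i) (?W x)) (?W y))"
        using i by (intro sums_sum cinner_tensor_op_sums[OF E] A_bounded W_in) auto
      \<comment> \<open>The defining relation of the \<open>A l i\<close>, evaluated at
        \<open>(?S' ^^ k) y\<close>: the exponents \<open>l\<close> and \<open>k\<close> add up to
        the coefficient index.\<close>
      moreover have "(\<Sum>l=0..p. adjoint_on E (A l i) (hardy_coeff (?W y) (k + l)))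
          = hardy_coeff (?W (adj (T i) y)) k" for k
        using A_eq[OF i, of "(?S' ^^ k) y"]
        by (simp add: hardy_coeff_model_map commute funpow_add add.commute[of k])
      ultimately have "(\<lambda>k. cinner (hardy_coeff (?W x) k) (hardy_coeff (?W (adj (T i) y)) k)) sums
          cinner (\<Sum>l=0..p. tensor_op E (M_z ^^ l) (A l i) (?W x)) (?W y)"
        by (simp add: cinner_sum_left flip: cinner_sum_right)
      then show "cinner (\<Sum>l=0..p. tensor_op E (M_z ^^ l) (A l i) (?W x)) (?W y)
          = cinner (?W x) (?W (adj (T i) y))"
        by (rule sums_unique2[OF _ hardy_cinner_sums])
    qed
  next
    have id: "bounded_op_on E id"
      by (auto simp: bounded_op_on_def linear_map_on_def intro: exI[of _ 1])
    show "unitarily_equivalent UNIV (T n) H (\<lambda>f. orth_proj H (tensor_op E M_z id f))"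
      unfolding H_def
    proof (rule unitarily_equivalent_compression[OF bounded])
      fix x y
      \<comment> \<open>Passing to the next coefficient of \<open>?W y\<close> amounts to applying
        \<open>?S'\<close> to \<open>y\<close>.\<close>
      have "adjoint_on E id (hardy_coeff (?W y) (k + 1)) = hardy_coeff (?W (?S' y)) k" for k
        using W_in[of y] E(1)
        by (simp add: adjoint_on_id hardy_space_def) (simp add: hardy_coeff_model_map funpow_swap1)
      with cinner_tensor_op_sums[OF E id W_in, of x "?W y" 1]
      have "(\<lambda>k. cinner (hardy_coeff (?W x) k) (hardy_coeff (?W (?S' y)) k)) sums
          cinner (tensor_op E M_z id (?W x)) (?W y)"
        by simp
      then show "cinner (tensor_op E M_z id (?W x)) (?W y) = cinner (?W x) (?W (?S' y))"
        by (rule sums_unique2[OF _ hardy_cinner_sums])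
    qed
  qed
qed

end
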